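(* Let $n\ge1$ and let $f$ be a complex-valued pluriharmonic function on $\mathbb{B}_{\ell_\infty^n}$ with $\sup_{z\in\mathbb{B}_{\ell_\infty^n}}\mathrm{Re}(f(z))\leq 1$. Then for every $z\in\mathbb{B}_{\ell_\infty^n}$ and every multi-index $m=(m_1,\ldots,m_n)\neq 0$, $$\left|\frac{\partial^{|m|}f(z)}{\partial z_1^{m_1}\cdots\partial z_n^{m_n}}+\overline{\frac{\partial^{|m|}f(z)}{\partial\overline{z}_1^{m_1}\cdots\partial\overline{z}_n^{m_n}}}\right|\leq 2\,(m!)\,\big(1-\mathrm{Re}(f(z))\big)\frac{(1+\|z\|_\infty)^{|m|-N}}{(1-\|z\|_\infty^2)^{|m|}},$$ where $N$ is the number of indices $j$ such that $m_j\neq 0$. Furthermore, the constant $2$ in this inequality cannot be improved.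
   Context: $\|z\|_\infty=\max_j|z_j|$; $\mathbb{B}_{\ell_\infty^n}=\{z\in\mathbb{C}^n:\|z\|_\infty<1\}$ is the unit polydisc. Multi-indices consist of nonnegative integers; $|m|=\sum_j m_j$, $m!=\prod_j m_j!$. A twice continuously differentiable complex-valued function $f$ on a domain $\Omega\subset\mathbb{C}^n$ is pluriharmonic if for each fixed $z\in\Omega$ and $\theta\in\mathbb{C}^n$ with $\|\theta\|_2=1$ (Euclidean norm), the function $\zeta\mapsto f(z+\zeta\theta)$ is harmonic in $\{\zeta\in\mathbb{C}:|\zeta|<d_\Omega(z)\}$, where $d_\Omega(z)$ is the Euclidean distance from $z$ to $\partial\Omega$. Derivatives are Wirtinger derivatives. *)

theory Defs
  imports "HOL-Analysis.Analysis"
begin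

definition linf_norm :: "complex ^ 'n \<Rightarrow> real" where
  "linf_norm z = (MAX j\<in>UNIV. cmod (z $ j))"

definition unit_polydisc :: "(complex ^ 'n) set" where
  "unit_polydisc = {z. linf_norm z < 1}"

text \<open>Real differentiability; intended for open \<open>S\<close>.\<close>

definition C2_on :: "'a::real_normed_vector set \<Rightarrow> ('a \<Rightarrow> 'b::real_normed_vector) \<Rightarrow> bool" where
  "C2_on S f \<longleftrightarrow>
    (\<exists>(D1 :: 'a \<Rightarrow> 'a \<Rightarrow>\<^sub>L 'b) (D2 :: 'a \<Rightarrow> 'a \<Rightarrow>\<^sub>L 'a \<Rightarrow>\<^sub>L 'b).
      (\<forall>x\<in>S. (f has_derivative blinfun_apply (D1 x)) (at x)) \<and>
      (\<forall>x\<in>S. (D1 has_derivative blinfun_apply (D2 x)) (at x)) \<and>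
      continuous_on S D2)"

definition dir_deriv :: "'a::real_normed_vector \<Rightarrow> ('a \<Rightarrow> complex) \<Rightarrow> 'a \<Rightarrow> complex" where
  "dir_deriv v f x = vector_derivative (\<lambda>t. f (x + t *\<^sub>R v)) (at 0)"

definition harmonic_on :: "complex set \<Rightarrow> (complex \<Rightarrow> complex) \<Rightarrow> bool" where
  "harmonic_on S g \<longleftrightarrow> C2_on S g \<and>
    (\<forall>\<zeta>\<in>S. dir_deriv 1 (dir_deriv 1 g) \<zeta> + dir_deriv \<i> (dir_deriv \<i> g) \<zeta> = 0)"

text \<open>
  The norm and distance of the type \<open>complex ^ 'n\<close> are the Euclidean ones.  Since
  \<open>infdist z {} = 0\<close>, an empty boundary (infinite boundary distance) is treated separately.
\<close>

definition pluriharmonic_on :: "(complex ^ ('n::finite)) set \<Rightarrow> (complex ^ 'n \<Rightarrow> complex) \<Rightarrow> bool" where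
  "pluriharmonic_on \<Omega> f \<longleftrightarrow> C2_on \<Omega> f \<and>
    (\<forall>z\<in>\<Omega>. \<forall>\<theta>. norm \<theta> = 1 \<longrightarrow>
      harmonic_on {\<zeta>. frontier \<Omega> = {} \<or> cmod \<zeta> < infdist z (frontier \<Omega>)} (\<lambda>\<zeta>. f (z + \<zeta> *s \<theta>)))"

definition wirtinger :: "'n::finite \<Rightarrow> (complex ^ 'n \<Rightarrow> complex) \<Rightarrow> complex ^ 'n \<Rightarrow> complex" where
  "wirtinger j f z = (dir_deriv (axis j 1) f z - \<i> * dir_deriv (axis j \<i>) f z) / 2"

definition wirtinger_bar :: "'n::finite \<Rightarrow> (complex ^ 'n \<Rightarrow> complex) \<Rightarrow> complex ^ 'n \<Rightarrow> complex" where
  "wirtinger_bar j f z = (dir_deriv (axis j 1) f z + \<i> * dir_deriv (axis j \<i>) f z) / 2"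

text \<open>
  For indices \<open>1 < \<dots> < n\<close>, \<open>mixed_deriv D m f\<close> is \<open>D 1\<close> applied \<open>m 1\<close> times to \<open>\<dots>\<close> to
  \<open>D n\<close> applied \<open>m n\<close> times to \<open>f\<close>.  The linear order on the index type serves only to fix
  the order in which the derivatives are taken.
\<close>

definition mixed_deriv ::
  "('n::{finite,linorder} \<Rightarrow> ((complex, 'n) vec \<Rightarrow> complex) \<Rightarrow> (complex, 'n) vec \<Rightarrow> complex)
    \<Rightarrow> ('n \<Rightarrow> nat) \<Rightarrow> ((complex, 'n) vec \<Rightarrow> complex) \<Rightarrow> (complex, 'n) vec \<Rightarrow> complex" where
  "mixed_deriv D m f = foldr (\<lambda>j. D j ^^ m j) (sorted_list_of_set UNIV) f"

definition mi_size :: "('n::finite \<Rightarrow> nat) \<Rightarrow> nat" where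
  "mi_size m = (\<Sum>j\<in>UNIV. m j)"

definition mi_fact :: "('n::finite \<Rightarrow> nat) \<Rightarrow> real" where
  "mi_fact m = (\<Prod>j\<in>UNIV. fact (m j))"

definition mi_supp_card :: "('n::finite \<Rightarrow> nat) \<Rightarrow> nat" where
  "mi_supp_card m = card {j. m j \<noteq> 0}"

end

theory Submission
  imports Defs "HOL-Complex_Analysis.Complex_Analysis"
begin

text \<open>
  Write \<open>f = h + cnj g\<close> with \<open>h\<close>, \<open>g\<close> holomorphic, and \<open>F = h + g\<close>.  Then \<open>Re F = Re f\<close>, and the
  expression to be estimated is the holomorphic derivative of \<open>F\<close> of order \<open>m\<close>.  For one variable,
  and \<open>p = 1 - F\<close> of nonnegative real part on the disc, Cauchy's formula on the circle of radius
  \<open>r\<close> represents \<open>p^(k) z / k!\<close> as the mean of \<open>2 * Re (p w) * w / (w - z)^(k+1)\<close>: the conjugate of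
  \<open>p\<close> may be added freely, because its mean against this kernel vanishes for \<open>k \<ge> 1\<close>.  The kernel
  is at most the Poisson kernel times \<open>r / ((r^2 - \<bar>z\<bar>^2) * (r - \<bar>z\<bar>)^(k-1))\<close>, the Poisson mean of
  \<open>Re p\<close> is \<open>Re (p z)\<close>, and \<open>r \<longrightarrow> 1\<close> gives the bound with its constant \<open>2\<close>
  (\<open>higher_deriv_le_Re\<close>).

  In several variables one differentiates one coordinate at a time.  The first coordinate costs the
  factor \<open>2\<close>.  From then on the derivative \<open>q\<close> reached so far is dominated in modulus by a constant
  multiple of \<open>1 - Re f\<close>, which on a slice in the next coordinate is again the real part of a
  holomorphic function; the same kernel estimate applied to \<open>q\<close> itself, with no conjugate added,
  brings no further factor \<open>2\<close> (\<open>higher_deriv_le_of_norm_le_Re\<close>).  Only coordinates in which one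
  really differentiates contribute \<open>(1 + t)^(k-1) / (1 - t^2)^k\<close>, hence the exponent
  \<open>\<bar>m\<bar> - N\<close> (\<open>mixed_bound\<close>).

  The global decomposition of \<open>f\<close> is avoided.  If \<open>f\<close> is pluriharmonic of class \<open>C2\<close>, then symmetry
  of the second derivative and polarization of the Laplace equation on complex lines show that each
  \<open>\<partial>f/\<partial>z_j\<close>, and the conjugate of each \<open>\<partial>f/\<partial>cnj z_j\<close>, is already holomorphic
  (\<open>sep_holo_first_derivative\<close>); a primitive on the slice through \<open>z\<close> in one coordinate replaces \<open>F\<close>.

  The constant is attained at the origin by \<open>- 2 * w / (1 - w)\<close> with \<open>w = z^m\<close>, whose real part is at
  most \<open>1\<close> because \<open>\<bar>w\<bar> < 1\<close>, and whose coefficient at \<open>z^m\<close> is \<open>- 2\<close>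
  (\<open>extremal_mixed_deriv_at_0\<close>).
\<close>

section \<open>Derivative estimates on the unit disc\<close>

text \<open>
  Dividing by \<open>2 * pi * \<i>\<close> turns contour integrals over the circle into means over the parameter
  \<open>x \<in> [0,1]\<close>, in which the Cauchy and Poisson formulas can be compared.
\<close>

lemma circle_has_integral:
  assumes "(h has_contour_integral I) (circlepath 0 r)"
  shows "((\<lambda>x. h (circlepath 0 r x) * circlepath 0 r x) has_integral I / (2 * pi * \<i>)) {0..1}"
proof -
  have "((\<lambda>x. h (circlepath 0 r x) * vector_derivative (circlepath 0 r) (at x within {0..1}))
      has_integral I) {0..1}"
    using assms by (simp add: has_contour_integral_def)
  from has_integral_mult_left[OF this, of "1 / (2 * pi * \<i>)"]
  have *: "((\<lambda>x. h (circlepath 0 r x) * vector_derivative (circlepath 0 r) (at x within {0..1})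
      * (1 / (2 * pi * \<i>))) has_integral I / (2 * pi * \<i>)) {0..1}"
    by simp
  have cancel: "u * (a * v) * (1 / a) = u * v" if "a \<noteq> 0" for a u v :: complex
    using that by simp
  show ?thesis
  proof (rule has_integral_eq[OF _ *])
    fix x :: real
    assume "x \<in> {0..1}"
    then have vd: "vector_derivative (circlepath 0 r) (at x within {0..1})
        = 2 * pi * \<i> * circlepath 0 r x"
      by (simp add: vector_derivative_circlepath01) (simp add: circlepath)
    show "h (circlepath 0 r x) * vector_derivative (circlepath 0 r) (at x within {0..1}) *
        (1 / (2 * pi * \<i>)) = h (circlepath 0 r x) * circlepath 0 r x"
      unfolding vd by (rule cancel) simp
  qed
qed

lemma Cauchy_circle_mean:
  assumes "g holomorphic_on ball 0 1" "r < 1" "cmod z < r"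
  shows "((\<lambda>x. g (circlepath 0 r x) * circlepath 0 r x / (circlepath 0 r x - z) ^ Suc k)
    has_integral (deriv ^^ k) g z / fact k) {0..1}"
proof -
  have sub: "cball 0 r \<subseteq> ball (0::complex) 1" using assms by auto
  have "((\<lambda>u. g u / (u-z) ^ (Suc k)) has_contour_integral
      ((2 * pi * \<i>) / (fact k) * (deriv ^^ k) g z)) (circlepath 0 r)"
    using assms sub
    by (intro Cauchy_has_contour_integral_higher_derivative_circlepath)
      (auto intro!: holomorphic_on_imp_continuous_on holomorphic_on_subset[OF assms(1)])
  from circle_has_integral[OF this] show ?thesis
    by simp
qed

lemma Cauchy_circle_zero:
  assumes "h holomorphic_on ball 0 R" "r < R" "0 < r"
  shows "((\<lambda>x. h (circlepath 0 r x) * circlepath 0 r x) has_integral 0) {0..1}"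
proof -
  have "(h has_contour_integral 0) (circlepath 0 r)"
    using assms by (intro Cauchy_theorem_convex_simple[of _ "ball 0 R"]) auto
  from circle_has_integral[OF this] show ?thesis by simp
qed

lemma circle_cnj:
  assumes "w = circlepath 0 r x"
  shows "w * cnj w = of_real (r\<^sup>2)"
  unfolding assms by (simp add: circlepath exp_cnj power2_eq_square flip: exp_add)

lemma circle_norm:
  assumes "0 < r"
  shows "cmod (circlepath 0 r x) = r"
  using assms by (simp add: circlepath norm_mult)

text \<open>
  The kernels obtained by conjugation have their pole at \<open>r^2 / cnj z\<close>, the mirror image of \<open>z\<close> in the
  circle of radius \<open>r\<close>; it stays away from a slightly larger disc, so Cauchy's theorem makes their
  means vanish.
\<close>

lemma reflected_pole_outside:
  assumes r: "r < 1" "cmod z < r"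
  obtains R where "r < R" "R < 1" "\<And>u. u \<in> ball 0 R \<Longrightarrow> of_real (r\<^sup>2) - cnj z * u \<noteq> 0"
proof -
  have r0: "0 < r" using r norm_ge_zero[of z] by linarith
  \<comment> \<open>The reflected pole has modulus \<open>r^2 / \<bar>z\<bar> > r\<close>.\<close>
  obtain R where R: "r < R" "R < 1" "R * cmod z < r\<^sup>2"
  proof (cases "z = 0")
    case True
    with that[of "(r+1)/2"] r r0 show ?thesis by simp
  next
    case False
    then have "r < r\<^sup>2 / cmod z"
      using r r0 by (simp add: field_simps power2_eq_square)
    then obtain R where "r < R" "R < min 1 (r\<^sup>2 / cmod z)"
      using dense[of r "min 1 (r\<^sup>2 / cmod z)"] r by auto
    with that[of R] False show ?thesis by (simp add: field_simps)
  qed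
  have nz: "of_real (r\<^sup>2) - cnj z * u \<noteq> 0" if "u \<in> ball 0 R" for u
  proof
    assume "of_real (r\<^sup>2) - cnj z * u = 0"
    then have "complex_of_real (r\<^sup>2) = cnj z * u" by simp
    then have "cmod (complex_of_real (r\<^sup>2)) = cmod z * cmod u" by (metis complex_mod_cnj norm_mult)
    then have "r\<^sup>2 = cmod z * cmod u" by (simp add: norm_power)
    also have "\<dots> \<le> R * cmod z"
      using that mult_right_mono[of "cmod u" R "cmod z"] by (simp add: mult.commute)
    finally show False using R by simp
  qed
  from that[OF R(1,2) nz] show ?thesis by blast
qed

text \<open>
  On the circle \<open>r^2 - cnj z * w = w * (cnj w - cnj z)\<close>, so the Poisson kernel is the sum of the Cauchy
  kernel \<open>w / (w - z)\<close> and of a kernel with reflected pole, whose contribution is zero.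
\<close>

lemma Poisson_circle_mean:
  assumes g: "g holomorphic_on ball 0 1" and r: "r < 1" "cmod z < r"
  shows "((\<lambda>x. g (circlepath 0 r x) *
      of_real ((r\<^sup>2 - (cmod z)\<^sup>2) / (cmod (circlepath 0 r x - z))\<^sup>2)) has_integral g z) {0..1}"
proof -
  have r0: "0 < r" using r norm_ge_zero[of z] by linarith
  obtain R where R: "r < R" "R < 1"
    and nz: "\<And>u. u \<in> ball 0 R \<Longrightarrow> of_real (r\<^sup>2) - cnj z * u \<noteq> 0"
    using reflected_pole_outside[OF r] by blast
  have 1: "((\<lambda>x. (\<lambda>u. g u * cnj z / (of_real (r\<^sup>2) - cnj z * u)) (circlepath 0 r x) * circlepath 0 r x)
      has_integral 0) {0..1}"
    by (rule Cauchy_circle_zero[of _ R])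
      (use R r0 nz in \<open>auto intro!: holomorphic_intros holomorphic_on_subset[OF g]\<close>)
  have 2: "((\<lambda>x. g (circlepath 0 r x) * circlepath 0 r x / (circlepath 0 r x - z)) has_integral g z) {0..1}"
    using Cauchy_circle_mean[OF g r, of 0] by simp
  have 3: "((\<lambda>x. g (circlepath 0 r x) * circlepath 0 r x / (circlepath 0 r x - z) +
      g (circlepath 0 r x) * cnj z / (of_real (r\<^sup>2) - cnj z * circlepath 0 r x) * circlepath 0 r x)
      has_integral g z) {0..1}"
    using has_integral_add[OF 2 1] by simp
  show ?thesis
  proof (rule has_integral_eq[OF _ 3])
    fix x
    define w where "w = circlepath 0 r x"
    have n: "cmod w = r" using circle_norm[OF r0] by (simp add: w_def)
    have wz: "w - z \<noteq> 0" using n r by auto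
    have w0: "w \<noteq> 0" using n r0 by auto
    have ww: "w * cnj w = of_real (r\<^sup>2)" by (rule circle_cnj[OF w_def])
    have cwz: "cnj w - cnj z \<noteq> 0" using wz by (metis complex_cnj_cancel_iff complex_cnj_diff right_minus_eq)
    have den: "of_real (r\<^sup>2) - cnj z * w = w * (cnj w - cnj z)"
      by (simp only: ww[symmetric]) (simp add: algebra_simps)
    have "w / (w - z) + cnj z * w / (of_real (r\<^sup>2) - cnj z * w)
        = w / (w - z) + cnj z / (cnj w - cnj z)"
      unfolding den using w0 by simp
    also have "\<dots> = (w * cnj w - z * cnj z) / ((w - z) * (cnj w - cnj z))"
      using wz cwz by (simp add: field_simps)
    also have "\<dots> = of_real ((r\<^sup>2 - (cmod z)\<^sup>2) / (cmod (w - z))\<^sup>2)"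
      by (simp add: ww complex_norm_square del: of_real_power)
    finally have "of_real ((r\<^sup>2 - (cmod z)\<^sup>2) / (cmod (w - z))\<^sup>2)
      = w / (w - z) + cnj z * w / (of_real (r\<^sup>2) - cnj z * w)" ..
    from arg_cong[OF this, of "\<lambda>t. g w * t"]
    show "g (circlepath 0 r x) * circlepath 0 r x / (circlepath 0 r x - z) +
         g (circlepath 0 r x) * cnj z / (of_real (r\<^sup>2) - cnj z * circlepath 0 r x) * circlepath 0 r x =
         g (circlepath 0 r x) * of_real ((r\<^sup>2 - (cmod z)\<^sup>2) / (cmod (circlepath 0 r x - z))\<^sup>2)"
      unfolding w_def[symmetric] by (simp add: distrib_left del: of_real_power)
  qed
qed

lemma Re_times_of_real: "Re (w * of_real a) = Re w * a"
  by simp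

text \<open>
  Since \<open>r - \<bar>z\<bar> \<le> \<bar>w - z\<bar>\<close> on the circle, two of the \<open>k + 2\<close> powers of \<open>w - z\<close> in the denominator
  give the Poisson kernel and the other \<open>k\<close> a constant.  The function \<open>\<phi>\<close> stands
  for a holomorphic \<open>q\<close> in one application and for \<open>p + cnj p\<close> in the other.
\<close>

lemma kernel_bound:
  assumes p: "p holomorphic_on ball 0 1" and r: "r < 1" "cmod z < r"
    and le: "\<And>w. cmod w = r \<Longrightarrow> cmod (\<phi> w) \<le> Re (p w)"
    and I: "((\<lambda>x. \<phi> (circlepath 0 r x) * circlepath 0 r x / (circlepath 0 r x - z) ^ Suc (Suc k))
      has_integral I) {0..1}"
  shows "cmod I \<le> Re (p z) * (r / ((r\<^sup>2 - (cmod z)\<^sup>2) * (r - cmod z) ^ k))"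
proof -
  define c where "c = r / ((r\<^sup>2 - (cmod z)\<^sup>2) * (r - cmod z) ^ k)"
  have r0: "0 < r" using r norm_ge_zero[of z] by linarith
  have d: "0 < r\<^sup>2 - (cmod z)\<^sup>2" using r by (simp add: power_strict_mono)
  have "((\<lambda>x. Re (p (circlepath 0 r x) *
      of_real ((r\<^sup>2 - (cmod z)\<^sup>2) / (cmod (circlepath 0 r x - z))\<^sup>2))) has_integral Re (p z)) {0..1}"
    using has_integral_linear[OF Poisson_circle_mean[OF p r] bounded_linear_Re]
    by (simp add: o_def del: Re_complex_of_real)
  then have "((\<lambda>x. Re (p (circlepath 0 r x)) *
      ((r\<^sup>2 - (cmod z)\<^sup>2) / (cmod (circlepath 0 r x - z))\<^sup>2)) has_integral Re (p z)) {0..1}"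
    by (simp only: Re_times_of_real)
  from has_integral_mult_left[OF this, of c]
  have P: "((\<lambda>x. Re (p (circlepath 0 r x)) *
      ((r\<^sup>2 - (cmod z)\<^sup>2) / (cmod (circlepath 0 r x - z))\<^sup>2) * c) has_integral Re (p z) * c) {0..1}" .
  have "norm I \<le> (Re (p z) * c) \<bullet> 1"
  proof (rule has_integral_norm_bound_integral_component[OF I P])
    fix x :: real
    define w where "w = circlepath 0 r x"
    have n: "cmod w = r" using circle_norm[OF r0] by (simp add: w_def)
    have low: "r - cmod z \<le> cmod (w - z)" using norm_triangle_ineq2[of w z] n by simp
    have wz: "0 < cmod (w - z)" "0 < r - cmod z" using low r by linarith+
    have pos: "0 \<le> Re (p w)" using le[OF n] norm_ge_zero order_trans by blast
    have "cmod (\<phi> w * w / (w - z) ^ Suc (Suc k))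
        = cmod (\<phi> w) * (r / ((cmod (w - z))\<^sup>2 * cmod (w - z) ^ k))"
      by (simp add: norm_divide norm_mult norm_power n power2_eq_square mult.assoc)
    also have "\<dots> \<le> Re (p w) * (r / ((cmod (w - z))\<^sup>2 * (r - cmod z) ^ k))"
      using le[OF n] pos r0 wz low
      by (intro mult_mono divide_left_mono mult_left_mono power_mono) auto
    also have "\<dots> = Re (p w) * ((r\<^sup>2 - (cmod z)\<^sup>2) / (cmod (w - z))\<^sup>2) * c"
      using d wz by (simp add: c_def divide_simps)
    finally show "norm (\<phi> (circlepath 0 r x) * circlepath 0 r x / (circlepath 0 r x - z) ^ Suc (Suc k))
      \<le> (Re (p (circlepath 0 r x)) *
          ((r\<^sup>2 - (cmod z)\<^sup>2) / (cmod (circlepath 0 r x - z))\<^sup>2) * c) \<bullet> 1"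
      unfolding w_def[symmetric] by simp
  qed
  then show ?thesis by (simp add: c_def)
qed

text \<open>
  The truncated subtraction makes this \<open>1\<close> for \<open>k = 0\<close>, so a coordinate in which no derivative is
  taken contributes nothing to a product of these factors.
\<close>

definition disc_factor :: "nat \<Rightarrow> real \<Rightarrow> real" where
  "disc_factor k t = (1 + t) ^ (k - 1) / (1 - t\<^sup>2) ^ k"

text \<open>
  The estimate on circles of radius \<open>r < 1\<close> passes to the unit disc by continuity in \<open>r\<close>;
  \<open>1 - t^2 = (1 + t) * (1 - t)\<close> puts the limit in its final form.
\<close>

lemma radius_limit:
  assumes "\<And>r. t < r \<Longrightarrow> r < 1 \<Longrightarrow> a \<le> b * (r / ((r\<^sup>2 - t\<^sup>2) * (r - t) ^ k))"
    and "0 \<le> t" "t < 1"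
  shows "a \<le> b * disc_factor (Suc k) t"
proof -
  have t2: "1 - t\<^sup>2 = (1 + t) * (1 - t)" by (simp add: algebra_simps power2_eq_square)
  have "a \<le> b * (1 / ((1\<^sup>2 - t\<^sup>2) * (1 - t) ^ k))"
  proof (rule tendsto_lowerbound)
    show "((\<lambda>r. b * (r / ((r\<^sup>2 - t\<^sup>2) * (r - t) ^ k))) \<longlongrightarrow> b * (1 / ((1\<^sup>2 - t\<^sup>2) * (1 - t) ^ k)))
      (at_left 1)"
      using assms(2,3) by (intro tendsto_intros) (auto simp: t2)
    show "\<forall>\<^sub>F r in at_left 1. a \<le> b * (r / ((r\<^sup>2 - t\<^sup>2) * (r - t) ^ k))"
      using eventually_at_left_real[OF assms(3)] by eventually_elim (use assms(1) in auto)
  qed simp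
  also have "1 / ((1\<^sup>2 - t\<^sup>2) * (1 - t) ^ k) = disc_factor (Suc k) t"
    using assms(2,3) by (simp add: disc_factor_def t2 power_mult_distrib)
  finally show ?thesis .
qed

text \<open>
  The kernel estimate applies to Cauchy's formula for \<open>q\<close> as it stands.  With the modulus of \<open>q\<close> under
  control no conjugate has to be added, hence no factor \<open>2\<close>.
\<close>

lemma higher_deriv_le_of_norm_le_Re:
  assumes "p holomorphic_on ball 0 1" "q holomorphic_on ball 0 1"
    and "\<And>w. cmod w < 1 \<Longrightarrow> cmod (q w) \<le> Re (p w)" and "cmod z < 1"
  shows "cmod ((deriv ^^ k) q z) \<le> Re (p z) * (fact k * disc_factor k (cmod z))"
proof (cases k)
  case 0
  then show ?thesis using assms by (simp add: disc_factor_def)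
next
  case (Suc l)
  have "cmod ((deriv ^^ k) q z / fact k) \<le> Re (p z) * disc_factor (Suc l) (cmod z)"
  proof (rule radius_limit)
    fix r assume r: "cmod z < r" "r < 1"
    show "cmod ((deriv ^^ k) q z / fact k) \<le> Re (p z) * (r / ((r\<^sup>2 - (cmod z)\<^sup>2) * (r - cmod z) ^ l))"
      using Cauchy_circle_mean[OF assms(2) r(2,1), of k] r assms unfolding Suc
      by (intro kernel_bound[of _ _ _ q]) auto
  qed (use assms in auto)
  then show ?thesis
    by (simp add: norm_divide Suc pos_divide_le_eq mult_ac del: fact_Suc funpow.simps)
qed

text \<open>
  Adding \<open>cnj p\<close> to \<open>p\<close> under the Cauchy integral is free for \<open>k \<ge> 1\<close>: after conjugation and
  \<open>cnj w = r^2 / w\<close> the kernel becomes holomorphic in the disc, the factor \<open>w ^ (k - 1)\<close> being the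
  place where \<open>k \<ge> 1\<close> enters.  The sum \<open>p + cnj p\<close> is \<open>2 * Re p\<close>, nonnegative.
\<close>

lemma higher_deriv_le_Re:
  assumes p: "p holomorphic_on ball 0 1"
    and pos: "\<And>w. cmod w < 1 \<Longrightarrow> 0 \<le> Re (p w)" and z: "cmod z < 1" and k: "k \<noteq> 0"
  shows "cmod ((deriv ^^ k) p z) \<le> 2 * Re (p z) * (fact k * disc_factor k (cmod z))"
proof -
  obtain l where l: "k = Suc l" using k not0_implies_Suc by blast
  have "cmod ((deriv ^^ k) p z / fact k) \<le> 2 * Re (p z) * disc_factor (Suc l) (cmod z)"
  proof (rule radius_limit)
    fix r assume r: "cmod z < r" "r < 1"
    have r0: "0 < r" using r norm_ge_zero[of z] by linarith
    obtain R where R: "r < R" "R < 1"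
      and nz: "\<And>u. u \<in> ball 0 R \<Longrightarrow> of_real (r\<^sup>2) - cnj z * u \<noteq> 0"
      using reflected_pole_outside[OF r(2,1)] by blast
    \<comment> \<open>On the circle, \<open>cnj (h w * w)\<close> is \<open>cnj (p w)\<close> times the Cauchy kernel of order \<open>k + 1\<close>.\<close>
    define h where "h u = p u * of_real (r\<^sup>2) * u ^ l / (of_real (r\<^sup>2) - cnj z * u) ^ Suc k" for u
    have h: "((\<lambda>x. h (circlepath 0 r x) * circlepath 0 r x) has_integral 0) {0..1}"
      unfolding h_def by (rule Cauchy_circle_zero[of _ R])
        (use R r0 nz in \<open>auto intro!: holomorphic_intros holomorphic_on_subset[OF p] simp del: power_Suc\<close>)
    have hw: "cnj (h w * w) = cnj (p w) * w / (w - z) ^ Suc k" if "w = circlepath 0 r x" for w x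
    proof -
      have n: "cmod w = r" using circle_norm[OF r0] by (simp add: that)
      have wz: "w - z \<noteq> 0" using n r by auto
      have w0: "w \<noteq> 0" using n r0 by auto
      have ww: "w * cnj w = of_real (r\<^sup>2)" by (rule circle_cnj[OF that])
      have "cnj (h w * w) = cnj (p w) * (w * cnj w) * cnj w ^ k / (w * cnj w - z * cnj w) ^ Suc k"
        by (simp add: h_def l ww del: of_real_power)
      also have "w * cnj w - z * cnj w = (w - z) * cnj w" by (simp add: algebra_simps)
      finally show ?thesis using w0 wz by (simp add: power_mult_distrib)
    qed
    have h': "((\<lambda>x. cnj (p (circlepath 0 r x)) * circlepath 0 r x /
        (circlepath 0 r x - z) ^ Suc k) has_integral 0) {0..1}"
      using has_integral_linear[OF h bounded_linear_cnj] by (simp add: o_def hw del: complex_cnj_mult)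
    have "cmod ((deriv ^^ k) p z / fact k) \<le> Re (2 * p z) * (r / ((r\<^sup>2 - (cmod z)\<^sup>2) * (r - cmod z) ^ l))"
    proof (rule kernel_bound[of "\<lambda>w. 2 * p w" _ _ "\<lambda>w. p w + cnj (p w)"])
      show "(\<lambda>w. 2 * p w) holomorphic_on ball 0 1" using p by (intro holomorphic_intros)
      show "((\<lambda>x. (p (circlepath 0 r x) + cnj (p (circlepath 0 r x))) * circlepath 0 r x /
           (circlepath 0 r x - z) ^ Suc (Suc l)) has_integral (deriv ^^ k) p z / fact k) {0..1}"
        using has_integral_add[OF Cauchy_circle_mean[OF p r(2,1), of k] h']
        by (simp add: distrib_right add_divide_distrib l)
      show "cmod (p w + cnj (p w)) \<le> Re (2 * p w)" if "cmod w = r" for w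
        using pos[of w] r that by (simp add: complex_add_cnj del: of_real_mult)
    qed (use r in auto)
    then show "cmod ((deriv ^^ k) p z / fact k) \<le>
        2 * Re (p z) * (r / ((r\<^sup>2 - (cmod z)\<^sup>2) * (r - cmod z) ^ l))" by simp
  qed (use z in auto)
  then show ?thesis
    by (simp add: norm_divide l pos_divide_le_eq mult_ac del: fact_Suc funpow.simps)
qed

section \<open>Coordinate slices of the polydisc\<close>

definition vec_upd :: "complex ^ 'n \<Rightarrow> 'n \<Rightarrow> complex \<Rightarrow> complex ^ 'n" where
  "vec_upd z j \<zeta> = (\<chi> i. if i = j then \<zeta> else z $ i)"

lemma vec_upd_nth [simp]: "vec_upd z j \<zeta> $ i = (if i = j then \<zeta> else z $ i)"
  by (simp add: vec_upd_def)

lemma vec_upd_same [simp]: "vec_upd z j (z $ j) = z"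
  by (simp add: vec_eq_iff)

lemma vec_upd_upd [simp]: "vec_upd (vec_upd z j a) j b = vec_upd z j b"
  by (simp add: vec_eq_iff)

lemma vec_upd_commute: "j \<noteq> k \<Longrightarrow> vec_upd (vec_upd z k a) j b = vec_upd (vec_upd z j b) k a"
  by (auto simp: vec_eq_iff)

lemma norm_axis_complex: "norm (axis j (v :: complex)) = cmod v"
  by (simp add: norm_vec_def L2_set_def axis_def if_distrib[of norm] if_distrib[of "\<lambda>x. x\<^sup>2"] cong: if_cong)

lemma dist_vec_upd: "dist (vec_upd z j a) (vec_upd z j b) = dist a b"
proof -
  have "vec_upd z j a - vec_upd z j b = axis j (a - b)" by (simp add: vec_eq_iff axis_def)
  then show ?thesis by (simp add: dist_norm norm_axis_complex)
qed

lemma linf_norm_less_iff: "linf_norm z < t \<longleftrightarrow> (\<forall>j. cmod (z $ j) < t)"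
  by (simp add: linf_norm_def)

lemma nth_le_linf_norm: "cmod (z $ j) \<le> linf_norm z"
  by (simp add: linf_norm_def)

lemma mem_unit_polydisc: "z \<in> unit_polydisc \<longleftrightarrow> (\<forall>j. cmod (z $ j) < 1)"
  by (simp add: unit_polydisc_def linf_norm_less_iff)

lemma vec_upd_in_polydisc [simp]:
  "z \<in> unit_polydisc \<Longrightarrow> vec_upd z j \<zeta> \<in> unit_polydisc \<longleftrightarrow> cmod \<zeta> < 1"
  by (auto simp: mem_unit_polydisc)

lemma open_unit_polydisc: "open (unit_polydisc :: (complex ^ 'n) set)"
proof -
  have "unit_polydisc = (\<Inter>j::'n. {z. cmod (z $ j) < 1})"
    by (auto simp: mem_unit_polydisc)
  also have "open \<dots>"
    by (intro open_INT ballI open_Collect_less continuous_intros) auto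
  finally show ?thesis .
qed

lemma axis_complex_decompose:
  "axis j h = Re h *\<^sub>R axis j 1 + Im h *\<^sub>R axis j \<i>"
  by (simp add: vec_eq_iff axis_def complex_eq_iff)

lemma has_derivative_vec_upd:
  fixes z :: "complex ^ 'n"
  shows "((\<lambda>\<zeta>. vec_upd z j \<zeta>) has_derivative axis j) (at \<zeta>)"
proof -
  have bl: "bounded_linear (axis j :: complex \<Rightarrow> complex ^ 'n)"
    by (rule bounded_linear_intro[where K = 1])
      (auto simp: vec_eq_iff axis_def norm_axis_complex[unfolded axis_def])
  have "((\<lambda>\<zeta>. (z - axis j (z $ j)) + axis j \<zeta>) has_derivative axis j) (at \<zeta>)"
    by (auto intro!: derivative_eq_intros bounded_linear.has_derivative[OF bl])
  also have "(\<lambda>\<zeta>. (z - axis j (z $ j)) + axis j \<zeta>) = (\<lambda>\<zeta>. vec_upd z j \<zeta>)"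
    by (auto simp: vec_eq_iff axis_def fun_eq_iff)
  finally show ?thesis .
qed

section \<open>Separately holomorphic functions\<close>

definition coord_deriv :: "'n \<Rightarrow> (complex ^ 'n \<Rightarrow> complex) \<Rightarrow> complex ^ 'n \<Rightarrow> complex" where
  "coord_deriv j q z = deriv (\<lambda>\<zeta>. q (vec_upd z j \<zeta>)) (z $ j)"

text \<open>
  By Osgood's lemma these are exactly the holomorphic functions on the polydisc.  Local boundedness,
  rather than continuity, is what Cauchy's estimates need and reproduce.
\<close>

definition sep_holo :: "(complex ^ 'n \<Rightarrow> complex) \<Rightarrow> bool" where
  "sep_holo q \<longleftrightarrow>
    (\<forall>z\<in>unit_polydisc. \<exists>r>0. \<exists>B. \<forall>w\<in>ball z r. cmod (q w) \<le> B) \<and>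
    (\<forall>z\<in>unit_polydisc. \<forall>j. (\<lambda>\<zeta>. q (vec_upd z j \<zeta>)) holomorphic_on ball 0 1)"

lemma sep_holo_slice:
  "sep_holo q \<Longrightarrow> z \<in> unit_polydisc \<Longrightarrow> (\<lambda>\<zeta>. q (vec_upd z j \<zeta>)) holomorphic_on ball 0 1"
  by (simp add: sep_holo_def)

lemma sep_holo_isContI:
  fixes q :: "complex ^ 'n \<Rightarrow> complex"
  assumes "\<And>z. z \<in> unit_polydisc \<Longrightarrow> isCont q z"
    and "\<And>z j. z \<in> unit_polydisc \<Longrightarrow> (\<lambda>\<zeta>. q (vec_upd z j \<zeta>)) holomorphic_on ball 0 1"
  shows "sep_holo q"
  unfolding sep_holo_def
proof (intro conjI ballI allI)
  fix z :: "complex ^ 'n" assume "z \<in> unit_polydisc"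
  then obtain r where "0 < r" "\<And>w. dist w z < r \<Longrightarrow> dist (q w) (q z) < 1"
    using assms(1) unfolding continuous_at_eps_delta by (metis zero_less_one)
  moreover have "cmod (q w) \<le> cmod (q z) + 1" if "dist (q w) (q z) < 1" for w
    using that norm_triangle_ineq2[of "q w" "q z"] by (simp add: dist_norm)
  ultimately show "\<exists>r>0. \<exists>B. \<forall>w\<in>ball z r. cmod (q w) \<le> B"
    by (intro exI[of _ r] conjI exI[of _ "cmod (q z) + 1"]) (auto simp: dist_commute)
qed (rule assms(2))

text \<open>
  Cauchy's estimates for the first two derivatives and Taylor's formula.  The second bound is linear
  in \<open>h\<close> with a constant that depends only on \<open>B\<close> and \<open>\<rho>\<close>, so it is uniform over a family of slices.
\<close>

lemma difference_quotient_bound: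
  assumes g: "g holomorphic_on ball a (2 * \<rho>)" and B: "\<And>\<zeta>. \<zeta> \<in> ball a (2 * \<rho>) \<Longrightarrow> cmod (g \<zeta>) < B"
    and \<rho>: "0 < \<rho>"
  shows "cmod (deriv g a) \<le> B / \<rho>"
    and "0 < cmod h \<Longrightarrow> cmod h < \<rho> \<Longrightarrow> cmod ((g (a + h) - g a) / h - deriv g a) \<le> 2 * B / \<rho>\<^sup>2 * cmod h"
proof -
  have n: "cmod ((deriv ^^ k) g \<zeta>) \<le> fact k * B / \<rho> ^ k" if "0 < k" "\<zeta> \<in> ball a \<rho>" for k \<zeta>
  proof (rule Cauchy_higher_deriv_bound[of _ _ _ 0])
    have sub: "cball \<zeta> \<rho> \<subseteq> ball a (2 * \<rho>)"
    proof
      fix w assume "w \<in> cball \<zeta> \<rho>"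
      then show "w \<in> ball a (2 * \<rho>)"
        using that(2) dist_triangle[of a w \<zeta>] by simp
    qed
    show "g holomorphic_on ball \<zeta> \<rho>"
      using g by (rule holomorphic_on_subset) (rule order_trans[OF ball_subset_cball sub])
    show "continuous_on (cball \<zeta> \<rho>) g"
      using holomorphic_on_subset[OF g sub] by (rule holomorphic_on_imp_continuous_on)
    show "g w \<in> ball 0 B" if "w \<in> ball \<zeta> \<rho>" for w
      using B[of w] sub that by (auto simp: subset_eq)
  qed (use that \<rho> in auto)
  show "cmod (deriv g a) \<le> B / \<rho>"
    using n[of 1 a] \<rho> by simp
  assume h: "0 < cmod h" "cmod h < \<rho>"
  have "cmod (g (a + h) - (\<Sum>i\<le>1. (deriv ^^ i) g a * ((a + h) - a) ^ i / fact i))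
      \<le> (2 * B / \<rho>\<^sup>2) * cmod ((a + h) - a) ^ Suc 1 / fact 1"
  proof (rule complex_Taylor[where S = "ball a \<rho>" and f = "\<lambda>i. (deriv ^^ i) g", simplified funpow_0])
    show "((deriv ^^ i) g has_field_derivative (deriv ^^ Suc i) g x) (at x within ball a \<rho>)"
      if "x \<in> ball a \<rho>" "i \<le> 1" for i x
      using has_field_derivative_higher_deriv[OF g open_ball, of x i] that(1) \<rho>
      by (auto intro: has_field_derivative_at_within)
    show "cmod ((deriv ^^ Suc 1) g x) \<le> 2 * B / \<rho>\<^sup>2" if "x \<in> ball a \<rho>" for x
      using n[of 2 x] that by (simp add: numeral_2_eq_2)
  qed (use h \<rho> in \<open>auto simp: dist_norm\<close>)
  then have "cmod (g (a + h) - g a - deriv g a * h) \<le> 2 * B / \<rho>\<^sup>2 * (cmod h * cmod h)"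
    by (simp add: diff_diff_eq)
  moreover have "(g (a + h) - g a) / h - deriv g a = (g (a + h) - g a - deriv g a * h) / h"
    using h by (simp add: field_simps)
  ultimately show "cmod ((g (a + h) - g a) / h - deriv g a) \<le> 2 * B / \<rho>\<^sup>2 * cmod h"
    using h by (simp add: norm_divide pos_divide_le_eq mult_ac)
qed

text \<open>
  Near \<open>z\<close> the difference quotients in every coordinate converge to the coordinate derivative
  uniformly in the base point.
\<close>

lemma sep_holo_local:
  assumes q: "sep_holo q" and z: "z \<in> unit_polydisc"
  obtains r K where "0 < r" "ball z r \<subseteq> unit_polydisc"
    "\<And>w j. w \<in> ball z r \<Longrightarrow> cmod (coord_deriv j q w) \<le> K"
    "\<And>w j h. w \<in> ball z r \<Longrightarrow> 0 < cmod h \<Longrightarrow> cmod h < r \<Longrightarrow>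
      cmod ((q (vec_upd w j (w $ j + h)) - q w) / h - coord_deriv j q w) \<le> K * cmod h"
proof -
  obtain r1 B where r1: "0 < r1" "\<And>w. w \<in> ball z r1 \<Longrightarrow> cmod (q w) \<le> B"
    using q z unfolding sep_holo_def by blast
  obtain r2 where r2: "0 < r2" "ball z r2 \<subseteq> unit_polydisc"
    using open_unit_polydisc z openE by blast
  \<comment> \<open>A third of the radius leaves room for discs of radius \<open>2 * r\<close> in a coordinate direction around any point of \<open>ball z r\<close>.\<close>
  define r where "r = min r1 r2 / 3"
  have r: "0 < r" using r1 r2 by (simp add: r_def)
  have in3: "u \<in> unit_polydisc \<and> cmod (q u) < B + 1" if "u \<in> ball z (3 * r)" for u
    using that r1(2)[of u] r2(2) by (auto simp: r_def)
  have B0: "0 < B + 1" using in3[of z] r norm_ge_zero[of "q z"] by (simp del: norm_ge_zero)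
  define K where "K = max ((B + 1) / r) (2 * (B + 1) / r\<^sup>2)"
  have main: "cmod (coord_deriv j q w) \<le> (B + 1) / r"
    "0 < cmod h \<Longrightarrow> cmod h < r \<Longrightarrow>
      cmod ((q (vec_upd w j (w $ j + h)) - q w) / h - coord_deriv j q w) \<le> 2 * (B + 1) / r\<^sup>2 * cmod h"
    if w: "w \<in> ball z r" for w j h
  proof -
    have near: "vec_upd w j \<zeta> \<in> ball z (3 * r)" if "\<zeta> \<in> ball (w $ j) (2 * r)" for \<zeta>
    proof -
      have "dist w (vec_upd w j \<zeta>) = dist (w $ j) \<zeta>"
        using dist_vec_upd[of w j "w $ j" \<zeta>] by simp
      then show ?thesis using w that dist_triangle[of z "vec_upd w j \<zeta>" w] by simp
    qed
    have wP: "w \<in> unit_polydisc" using near[of "w $ j"] r in3 by simp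
    have sub: "ball (w $ j) (2 * r) \<subseteq> ball 0 1"
    proof
      fix \<zeta> assume "\<zeta> \<in> ball (w $ j) (2 * r)"
      from in3[OF near[OF this]] wP show "\<zeta> \<in> ball 0 1" by simp
    qed
    have hol: "(\<lambda>\<zeta>. q (vec_upd w j \<zeta>)) holomorphic_on ball (w $ j) (2 * r)"
      using sep_holo_slice[OF q wP] sub by (rule holomorphic_on_subset)
    note d = difference_quotient_bound[OF hol _ r, of "B + 1"]
    show "cmod (coord_deriv j q w) \<le> (B + 1) / r"
      unfolding coord_deriv_def by (rule d(1)) (use in3[OF near] in simp)
    show "cmod ((q (vec_upd w j (w $ j + h)) - q w) / h - coord_deriv j q w) \<le> 2 * (B + 1) / r\<^sup>2 * cmod h"
      if "0 < cmod h" "cmod h < r"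
      unfolding coord_deriv_def using d(2)[OF _ that] in3[OF near] by simp
  qed
  show ?thesis
  proof (rule that[of r K])
    show "ball z r \<subseteq> unit_polydisc" using in3 r by (auto simp: subset_eq)
    show "cmod (coord_deriv j q w) \<le> K" if "w \<in> ball z r" for w j
      using main(1)[OF that, of j] by (simp add: K_def)
    show "cmod ((q (vec_upd w j (w $ j + h)) - q w) / h - coord_deriv j q w) \<le> K * cmod h"
      if "w \<in> ball z r" "0 < cmod h" "cmod h < r" for w j h
    proof -
      have "2 * (B + 1) / r\<^sup>2 * cmod h \<le> K * cmod h"
        unfolding K_def by (intro mult_right_mono) auto
      then show ?thesis using main(2)[OF that, of j] by linarith
    qed
  qed (use r in auto)
qed

text \<open>
  In the coordinate of differentiation this is the one-variable fact.  In another coordinate \<open>k\<close>, the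
  derivative is a locally uniform limit of difference quotients, which are holomorphic in \<open>z_k\<close>.
\<close>

lemma sep_holo_coord_deriv:
  assumes q: "sep_holo q"
  shows "sep_holo (coord_deriv j q)"
  unfolding sep_holo_def
proof (intro conjI ballI allI)
  fix z :: "complex ^ 'a" assume z: "z \<in> unit_polydisc"
  show "\<exists>r>0. \<exists>B. \<forall>w\<in>ball z r. cmod (coord_deriv j q w) \<le> B"
    using sep_holo_local[OF q z] by metis
  fix k
  show "(\<lambda>\<zeta>. coord_deriv j q (vec_upd z k \<zeta>)) holomorphic_on ball 0 1"
  proof (cases "k = j")
    case True
    then show ?thesis
      using holomorphic_deriv[OF sep_holo_slice[OF q z, of j] open_ball] by (simp add: coord_deriv_def)
  next
    case False
    have zj: "cmod (z $ j) < 1" using z by (simp add: mem_unit_polydisc)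
    \<comment> \<open>Small increments keep the shifted coordinate inside the unit disc, so that every difference quotient is defined on the whole slice.\<close>
    obtain N where N: "inverse (real (Suc N)) < 1 - cmod (z $ j)"
      using reals_Archimedean[of "1 - cmod (z $ j)"] zj by auto
    define h where "h n = complex_of_real (inverse (real (Suc (N + n))))" for n
    have h: "0 < cmod (h n)" "cmod (h n) = inverse (real (Suc (N + n)))" for n
      by (simp_all add: h_def norm_inverse del: of_real_inverse of_real_of_nat_eq)
    have hN: "cmod (z $ j + h n) < 1" for n
    proof -
      have "cmod (h n) \<le> inverse (real (Suc N))" unfolding h by (simp add: field_simps)
      then show ?thesis using N norm_triangle_ineq[of "z $ j" "h n"] by linarith
    qed
    have h0: "h \<longlonglongrightarrow> 0"
    proof -
      have "(\<lambda>n. inverse (real (Suc (n + N)))) \<longlonglongrightarrow> 0"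
        by (rule LIMSEQ_ignore_initial_segment[OF LIMSEQ_inverse_real_of_nat])
      then have "(\<lambda>n. complex_of_real (inverse (real (Suc (n + N))))) \<longlonglongrightarrow> of_real 0"
        by (rule tendsto_of_real)
      then show ?thesis by (simp add: h_def[abs_def] add.commute)
    qed
    define F where "F n \<zeta> = (q (vec_upd (vec_upd z k \<zeta>) j (z $ j + h n)) - q (vec_upd z k \<zeta>)) / h n"
      for n \<zeta>
    show ?thesis
    proof (rule holomorphic_uniform_sequence[where f = F])
      fix n
      have "vec_upd z j (z $ j + h n) \<in> unit_polydisc" using hN z by simp
      from sep_holo_slice[OF q this, of k]
      have "(\<lambda>\<zeta>. q (vec_upd (vec_upd z k \<zeta>) j (z $ j + h n))) holomorphic_on ball 0 1"
        using False by (simp add: vec_upd_commute[of j k])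
      then show "F n holomorphic_on ball 0 1"
        unfolding F_def[abs_def] using h(1)[of n] sep_holo_slice[OF q z, of k]
        by (intro holomorphic_intros) auto
    next
      fix x :: complex assume x: "x \<in> ball 0 1"
      then have "vec_upd z k x \<in> unit_polydisc" using z by simp
      from sep_holo_local[OF q this] obtain r K where r: "0 < r"
        "ball (vec_upd z k x) r \<subseteq> unit_polydisc"
        and K: "\<And>w h. w \<in> ball (vec_upd z k x) r \<Longrightarrow> 0 < cmod h \<Longrightarrow> cmod h < r \<Longrightarrow>
          cmod ((q (vec_upd w j (w $ j + h)) - q w) / h - coord_deriv j q w) \<le> K * cmod h"
        by metis
      have near: "vec_upd z k \<zeta> \<in> ball (vec_upd z k x) r" if "\<zeta> \<in> cball x (r/2)" for \<zeta>
        using that r(1) by (simp add: dist_vec_upd)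
      have "uniform_limit (cball x (r/2)) F (\<lambda>\<zeta>. coord_deriv j q (vec_upd z k \<zeta>)) sequentially"
        unfolding uniform_limit_iff
      proof (intro allI impI)
        fix e :: real assume e: "0 < e"
        have "(\<lambda>n. norm (h n)) \<longlonglongrightarrow> 0" using h0 by (rule tendsto_norm_zero)
        then have "(\<lambda>n. K * norm (h n)) \<longlonglongrightarrow> K * 0" by (intro tendsto_intros)
        then have "\<forall>\<^sub>F n in sequentially. K * norm (h n) < e" using e by (auto dest: order_tendstoD)
        moreover have "\<forall>\<^sub>F n in sequentially. norm (h n) < r"
          using \<open>(\<lambda>n. norm (h n)) \<longlonglongrightarrow> 0\<close> r(1) by (auto dest: order_tendstoD)
        ultimately show "\<forall>\<^sub>F n in sequentially. \<forall>\<zeta>\<in>cball x (r/2). dist (F n \<zeta>) (coord_deriv j q (vec_upd z k \<zeta>)) < e"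
        proof eventually_elim
          case (elim n)
          show ?case
          proof
            fix \<zeta> assume "\<zeta> \<in> cball x (r/2)"
            from K[OF near[OF this] h(1) elim(2)] elim(1) False
            show "dist (F n \<zeta>) (coord_deriv j q (vec_upd z k \<zeta>)) < e"
              by (simp add: F_def dist_norm)
          qed
        qed
      qed
      moreover have "cball x (r/2) \<subseteq> ball 0 1"
      proof
        fix \<zeta> assume "\<zeta> \<in> cball x (r/2)"
        from near[OF this] r(2) z show "\<zeta> \<in> ball 0 1" by auto
      qed
      ultimately show "\<exists>d>0. cball x d \<subseteq> ball 0 1 \<and>
          uniform_limit (cball x d) F (\<lambda>\<zeta>. coord_deriv j q (vec_upd z k \<zeta>)) sequentially"
        using r(1) by (intro exI[of _ "r/2"]) auto
    qed simp
  qed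
qed

section \<open>Wirtinger derivatives of separately holomorphic functions\<close>

lemma dir_deriv_axis:
  assumes q: "sep_holo q" and z: "z \<in> unit_polydisc"
  shows "((\<lambda>t. q (z + t *\<^sub>R axis j v)) has_vector_derivative v * coord_deriv j q z) (at 0)"
proof -
  have "(\<lambda>\<zeta>. q (vec_upd z j \<zeta>)) field_differentiable at (z $ j)"
    using sep_holo_slice[OF q z, of j] z
    by (auto simp: mem_unit_polydisc intro: holomorphic_on_imp_differentiable_at)
  then have g: "((\<lambda>\<zeta>. q (vec_upd z j \<zeta>)) has_field_derivative coord_deriv j q z) (at (z $ j + of_real 0 * v))"
    by (simp add: coord_deriv_def field_differentiable_derivI)
  have "((\<lambda>t. z $ j + of_real t * v) has_vector_derivative v) (at 0)"
    by (auto intro!: derivative_eq_intros)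
  from field_vector_diff_chain_at[OF this g]
  show ?thesis
  proof (rule has_vector_derivative_transform_within[of _ _ _ _ 1])
    fix t :: real
    have "vec_upd z j (z $ j + of_real t * v) = z + t *\<^sub>R axis j v"
      by (auto simp: vec_eq_iff axis_def scaleR_conv_of_real[where 'a = complex])
    then show "((\<lambda>\<zeta>. q (vec_upd z j \<zeta>)) \<circ> (\<lambda>t. z $ j + of_real t * v)) t = q (z + t *\<^sub>R axis j v)"
      by simp
  qed auto
qed

lemma wirtinger_sep_holo:
  assumes "sep_holo q" "z \<in> unit_polydisc"
  shows "wirtinger j q z = coord_deriv j q z" "wirtinger_bar j q z = 0"
proof -
  have "dir_deriv (axis j v) q z = v * coord_deriv j q z" for v
    unfolding dir_deriv_def by (rule vector_derivative_at[OF dir_deriv_axis[OF assms]])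
  then show "wirtinger j q z = coord_deriv j q z" "wirtinger_bar j q z = 0"
    by (simp_all add: wirtinger_def wirtinger_bar_def)
qed

lemma wirtinger_bar_cnj_sep_holo:
  assumes "sep_holo (\<lambda>w. cnj (q w))" "z \<in> unit_polydisc"
  shows "cnj (wirtinger_bar j q z) = coord_deriv j (\<lambda>w. cnj (q w)) z"
proof -
  have "((\<lambda>t. cnj (cnj (q (z + t *\<^sub>R axis j v)))) has_vector_derivative
      cnj (v * coord_deriv j (\<lambda>w. cnj (q w)) z)) (at 0)" for v
    by (rule bounded_linear.has_vector_derivative[OF bounded_linear_cnj dir_deriv_axis[OF assms]])
  then have "dir_deriv (axis j v) q z = cnj (v * coord_deriv j (\<lambda>w. cnj (q w)) z)" for v
    unfolding dir_deriv_def by (simp add: vector_derivative_at)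
  then show ?thesis by (simp add: wirtinger_bar_def)
qed

lemma dir_deriv_cong:
  assumes "\<And>w. w \<in> unit_polydisc \<Longrightarrow> q w = q' w" "z \<in> unit_polydisc"
  shows "dir_deriv v q z = dir_deriv v q' z"
  unfolding dir_deriv_def
proof (rule vector_derivative_cong_eq)
  have "((\<lambda>t. z + t *\<^sub>R v) \<longlongrightarrow> z + 0 *\<^sub>R v) (nhds 0)"
    by (intro tendsto_intros filterlim_ident)
  then have "\<forall>\<^sub>F t in nhds 0. z + t *\<^sub>R v \<in> unit_polydisc"
    using assms(2) open_unit_polydisc by (auto dest: topological_tendstoD)
  then show "\<forall>\<^sub>F t in nhds 0. t \<in> UNIV \<longrightarrow> q (z + t *\<^sub>R v) = q' (z + t *\<^sub>R v)"
    by eventually_elim (simp add: assms(1))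
qed (use assms in auto)

lemma wirtinger_cong:
  assumes "\<And>w. w \<in> unit_polydisc \<Longrightarrow> q w = q' w" "z \<in> unit_polydisc"
  shows "wirtinger j q z = wirtinger j q' z" "wirtinger_bar j q z = wirtinger_bar j q' z"
  using dir_deriv_cong[OF assms] by (simp_all add: wirtinger_def wirtinger_bar_def)

lemma sep_holo_cong:
  assumes "\<And>w. w \<in> unit_polydisc \<Longrightarrow> q w = q' w" "sep_holo q"
  shows "sep_holo q'"
  unfolding sep_holo_def
proof (intro conjI ballI allI)
  fix z :: "complex ^ 'a" assume z: "z \<in> unit_polydisc"
  obtain r B where r: "0 < r" "\<And>w. w \<in> ball z r \<Longrightarrow> cmod (q w) \<le> B"
    using assms(2) z unfolding sep_holo_def by blast
  obtain s where s: "0 < s" "ball z s \<subseteq> unit_polydisc"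
    using open_unit_polydisc z openE by blast
  have "cmod (q' w) \<le> B" if "w \<in> ball z (min r s)" for w
  proof -
    have "w \<in> unit_polydisc" "w \<in> ball z r" using that s by auto
    then show ?thesis using r(2)[of w] assms(1)[of w] by simp
  qed
  then show "\<exists>r>0. \<exists>B. \<forall>w\<in>ball z r. cmod (q' w) \<le> B"
    using r(1) s(1) by (intro exI[of _ "min r s"] conjI exI[of _ B]) auto
  show "(\<lambda>\<zeta>. q' (vec_upd z j \<zeta>)) holomorphic_on ball 0 1" for j
    by (rule holomorphic_transform[OF sep_holo_slice[OF assms(2) z, of j]]) (use assms(1) z in simp)
qed

lemma coord_deriv_funpow_slice:
  "(coord_deriv j ^^ k) q (vec_upd z j \<zeta>) = (deriv ^^ k) (\<lambda>\<xi>. q (vec_upd z j \<xi>)) \<zeta>"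
proof (induction k arbitrary: \<zeta>)
  case (Suc k)
  have "(\<lambda>\<xi>. (coord_deriv j ^^ k) q (vec_upd z j \<xi>)) = (deriv ^^ k) (\<lambda>\<xi>. q (vec_upd z j \<xi>))"
    using Suc.IH by (rule ext)
  then show ?case by (simp add: coord_deriv_def[of j "(coord_deriv j ^^ k) q"])
qed simp

lemma coord_deriv_funpow: "(coord_deriv j ^^ k) q z = (deriv ^^ k) (\<lambda>\<xi>. q (vec_upd z j \<xi>)) (z $ j)"
  using coord_deriv_funpow_slice[of k j q z "z $ j"] by simp

lemma sep_holo_coord_deriv_funpow: "sep_holo q \<Longrightarrow> sep_holo ((coord_deriv j ^^ k) q)"
  by (induction k) (auto intro: sep_holo_coord_deriv)

lemma wirtinger_funpow:
  assumes "sep_holo q"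
  shows "z \<in> unit_polydisc \<Longrightarrow> (wirtinger j ^^ k) q z = (coord_deriv j ^^ k) q z"
proof (induction k arbitrary: z)
  case (Suc k)
  have "wirtinger j ((wirtinger j ^^ k) q) z = wirtinger j ((coord_deriv j ^^ k) q) z"
    by (rule wirtinger_cong) (use Suc in auto)
  then show ?case
    using wirtinger_sep_holo(1)[OF sep_holo_coord_deriv_funpow[OF assms] Suc.prems] by simp
qed simp

lemma wirtinger_bar_funpow_cnj:
  assumes "sep_holo (\<lambda>w. cnj (q w))"
  shows "z \<in> unit_polydisc \<Longrightarrow> cnj ((wirtinger_bar j ^^ k) q z) = (coord_deriv j ^^ k) (\<lambda>w. cnj (q w)) z"
proof (induction k arbitrary: z)
  case (Suc k)
  let ?Q = "(coord_deriv j ^^ k) (\<lambda>w. cnj (q w))"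
  have "wirtinger_bar j ((wirtinger_bar j ^^ k) q) z = wirtinger_bar j (\<lambda>w. cnj (?Q w)) z"
    by (rule wirtinger_cong) (use Suc in \<open>auto simp flip: Suc.IH\<close>)
  then show ?case
    using wirtinger_bar_cnj_sep_holo[where q = "\<lambda>w. cnj (?Q w)"] sep_holo_coord_deriv_funpow[OF assms] Suc.prems
    by simp
qed simp

text \<open>
  For \<open>f = h + cnj g\<close>, the functions \<open>a\<close> and \<open>cnj b\<close> are derivatives of \<open>h\<close> and of \<open>g\<close> reached so
  far.  Conjugation makes both kinds of Wirtinger derivative act as one complex derivative on the
  slices of \<open>a + cnj b\<close>.
\<close>

lemma wirtinger_pair_funpow:
  assumes A: "sep_holo a" and B: "sep_holo (\<lambda>w. cnj (b w))"
  shows "sep_holo ((wirtinger j ^^ k) a)" "sep_holo (\<lambda>w. cnj ((wirtinger_bar j ^^ k) b w))"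
    and "z \<in> unit_polydisc \<Longrightarrow> (wirtinger j ^^ k) a z + cnj ((wirtinger_bar j ^^ k) b z)
      = (deriv ^^ k) (\<lambda>\<zeta>. a (vec_upd z j \<zeta>) + cnj (b (vec_upd z j \<zeta>))) (z $ j)"
proof -
  show "sep_holo ((wirtinger j ^^ k) a)"
    by (rule sep_holo_cong[OF _ sep_holo_coord_deriv_funpow[OF A]]) (simp add: wirtinger_funpow[OF A])
  show "sep_holo (\<lambda>w. cnj ((wirtinger_bar j ^^ k) b w))"
    by (rule sep_holo_cong[OF _ sep_holo_coord_deriv_funpow[OF B]]) (simp add: wirtinger_bar_funpow_cnj[OF B])
  assume z: "z \<in> unit_polydisc"
  then have "z $ j \<in> ball 0 1" by (simp add: mem_unit_polydisc)
  then show "(wirtinger j ^^ k) a z + cnj ((wirtinger_bar j ^^ k) b z)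
      = (deriv ^^ k) (\<lambda>\<zeta>. a (vec_upd z j \<zeta>) + cnj (b (vec_upd z j \<zeta>))) (z $ j)"
    unfolding wirtinger_funpow[OF A z] wirtinger_bar_funpow_cnj[OF B z] coord_deriv_funpow
    by (intro higher_deriv_add[symmetric, of _ "ball 0 1"] sep_holo_slice[OF A z] sep_holo_slice[OF B z]) auto
qed

section \<open>Iterating the one-variable estimates over the coordinates\<close>

text \<open>
  The induction follows the order in which the derivatives are taken.  The first coordinate that is
  differentiated uses the slice primitive \<open>p\<close> and costs the factor \<open>2\<close>; each later one uses that the
  function reached so far is dominated by \<open>1 - Re f\<close> times factors in the coordinates already
  processed, which are constant along the slice in the new coordinate.
\<close>

lemma mixed_bound:
  fixes f :: "complex ^ 'n \<Rightarrow> complex" and m :: "'n \<Rightarrow> nat"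
  assumes W: "\<And>j. sep_holo (wirtinger j f)"
    and Wb: "\<And>j. sep_holo (\<lambda>w. cnj (wirtinger_bar j f w))"
    and p: "\<And>z j. z \<in> unit_polydisc \<Longrightarrow> \<exists>p. p holomorphic_on ball 0 1 \<and>
      (\<forall>\<zeta>\<in>ball 0 1. Re (p \<zeta>) = 1 - Re (f (vec_upd z j \<zeta>)) \<and>
        deriv p \<zeta> = - (wirtinger j f (vec_upd z j \<zeta>) + cnj (wirtinger_bar j f (vec_upd z j \<zeta>))))"
    and le: "\<And>w. w \<in> unit_polydisc \<Longrightarrow> Re (f w) \<le> 1"
  defines "a \<equiv> \<lambda>xs. foldr (\<lambda>j. wirtinger j ^^ m j) xs f"
    and "b \<equiv> \<lambda>xs. foldr (\<lambda>j. wirtinger_bar j ^^ m j) xs f"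
  assumes "distinct xs" "\<exists>j\<in>set xs. m j \<noteq> 0"
  shows "sep_holo (a xs) \<and> sep_holo (\<lambda>w. cnj (b xs w)) \<and> (\<forall>z\<in>unit_polydisc.
    cmod (a xs z + cnj (b xs z)) \<le>
      2 * (1 - Re (f z)) * (\<Prod>j\<in>set xs. fact (m j) * disc_factor (m j) (cmod (z $ j))))"
  using assms(7,8)
proof (induction xs)
  case (Cons j xs)
  have a: "a (j # xs) = (wirtinger j ^^ m j) (a xs)" and b: "b (j # xs) = (wirtinger_bar j ^^ m j) (b xs)"
    by (simp_all add: a_def b_def)
  define \<beta> where "\<beta> xs z = (\<Prod>j\<in>set xs. fact (m j) * disc_factor (m j) (cmod (z $ j)))"
    for xs and z :: "complex ^ 'n"
  have \<beta>: "\<beta> (j # xs) z = fact (m j) * disc_factor (m j) (cmod (z $ j)) * \<beta> xs z" for z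
    using Cons.prems(1) by (simp add: \<beta>_def)
  show ?case
  proof (cases "m j = 0")
    case True
    then show ?thesis using Cons by (simp add: a b disc_factor_def)
  next
    case mj: False
    show ?thesis
    proof (cases "\<exists>i\<in>set xs. m i \<noteq> 0")
      case True
      have IH: "sep_holo (a xs)" "sep_holo (\<lambda>w. cnj (b xs w))" "\<And>z. z \<in> unit_polydisc \<Longrightarrow>
          cmod (a xs z + cnj (b xs z)) \<le> 2 * (1 - Re (f z)) * \<beta> xs z"
        using Cons.IH True Cons.prems(1) by (auto simp: \<beta>_def)
      note pair = wirtinger_pair_funpow[OF IH(1,2), where j = j and k = "m j"]
      have "cmod (a (j # xs) z + cnj (b (j # xs) z)) \<le> 2 * (1 - Re (f z)) * \<beta> (j # xs) z"
        if z: "z \<in> unit_polydisc" for z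
      proof -
        obtain p where p: "p holomorphic_on ball 0 1"
          "\<And>\<zeta>. \<zeta> \<in> ball 0 1 \<Longrightarrow> Re (p \<zeta>) = 1 - Re (f (vec_upd z j \<zeta>))"
          using assms(3)[OF z, of j] by blast
        have zj: "cmod (z $ j) < 1" using z by (simp add: mem_unit_polydisc)
        define q where "q \<zeta> = a xs (vec_upd z j \<zeta>) + cnj (b xs (vec_upd z j \<zeta>))" for \<zeta>
        have "cmod ((deriv ^^ m j) q (z $ j))
            \<le> Re (of_real (2 * \<beta> xs z) * p (z $ j)) * (fact (m j) * disc_factor (m j) (cmod (z $ j)))"
        proof (rule higher_deriv_le_of_norm_le_Re)
          show "q holomorphic_on ball 0 1"
            unfolding q_def[abs_def]
            by (intro holomorphic_intros sep_holo_slice[OF _ z] IH)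
          show "(\<lambda>\<zeta>. of_real (2 * \<beta> xs z) * p \<zeta>) holomorphic_on ball 0 1"
            by (intro holomorphic_intros p)
          fix \<zeta> :: complex assume \<zeta>: "cmod \<zeta> < 1"
          have "\<beta> xs (vec_upd z j \<zeta>) = \<beta> xs z"
            unfolding \<beta>_def using Cons.prems(1) by (intro prod.cong) auto
          then have "cmod (q \<zeta>) \<le> 2 * (1 - Re (f (vec_upd z j \<zeta>))) * \<beta> xs z"
            using IH(3)[of "vec_upd z j \<zeta>"] z \<zeta> by (simp add: q_def)
          also have "\<dots> = Re (of_real (2 * \<beta> xs z) * p \<zeta>)"
            using p(2)[of \<zeta>] \<zeta> by simp
          finally show "cmod (q \<zeta>) \<le> Re (of_real (2 * \<beta> xs z) * p \<zeta>)" .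
        qed (use zj in auto)
        also have "(deriv ^^ m j) q (z $ j) = a (j # xs) z + cnj (b (j # xs) z)"
          using pair(3)[OF z] by (simp add: a b q_def[abs_def])
        also have "Re (of_real (2 * \<beta> xs z) * p (z $ j)) * (fact (m j) * disc_factor (m j) (cmod (z $ j)))
            = 2 * (1 - Re (f z)) * \<beta> (j # xs) z"
          using p(2)[of "z $ j"] zj by (simp add: \<beta>)
        finally show ?thesis .
      qed
      then show ?thesis using pair(1,2) by (simp add: a b \<beta>_def)
    next
      case False
      obtain l where l: "m j = Suc l" using mj not0_implies_Suc by blast
      have "foldr (\<lambda>j. D j ^^ m j) xs f = f" for D :: "'n \<Rightarrow> (complex ^ 'n \<Rightarrow> complex) \<Rightarrow> _"
        using False by (induction xs) auto
      then have triv: "a xs = f" "b xs = f" by (simp_all add: a_def b_def)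
      have a': "a (j # xs) = (wirtinger j ^^ l) (wirtinger j f)"
        and b': "b (j # xs) = (wirtinger_bar j ^^ l) (wirtinger_bar j f)"
        by (simp_all add: a b triv l funpow_Suc_right del: funpow.simps)
      note pair = wirtinger_pair_funpow[OF W Wb, where k = l]
      have \<beta>1: "\<beta> xs z = 1" for z
        unfolding \<beta>_def using False by (intro prod.neutral) (simp add: disc_factor_def)
      have "cmod (a (j # xs) z + cnj (b (j # xs) z)) \<le> 2 * (1 - Re (f z)) * \<beta> (j # xs) z"
        if z: "z \<in> unit_polydisc" for z
      proof -
        obtain p where p: "p holomorphic_on ball 0 1"
          "\<And>\<zeta>. \<zeta> \<in> ball 0 1 \<Longrightarrow> Re (p \<zeta>) = 1 - Re (f (vec_upd z j \<zeta>))"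
          "\<And>\<zeta>. \<zeta> \<in> ball 0 1 \<Longrightarrow> deriv p \<zeta>
            = - (wirtinger j f (vec_upd z j \<zeta>) + cnj (wirtinger_bar j f (vec_upd z j \<zeta>)))"
          using assms(3)[OF z, of j] by blast
        have zj: "cmod (z $ j) < 1" using z by (simp add: mem_unit_polydisc)
        define q where "q \<zeta> = wirtinger j f (vec_upd z j \<zeta>) + cnj (wirtinger_bar j f (vec_upd z j \<zeta>))" for \<zeta>
        have q: "q holomorphic_on ball 0 1"
          unfolding q_def[abs_def] by (intro holomorphic_intros sep_holo_slice[OF _ z] W Wb)
        have "(deriv ^^ m j) p (z $ j) = (deriv ^^ l) (deriv p) (z $ j)"
          by (simp add: l funpow_Suc_right del: funpow.simps)
        also have "\<dots> = (deriv ^^ l) (\<lambda>\<zeta>. - q \<zeta>) (z $ j)"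
        proof (rule higher_deriv_transform_within_open[of _ "ball 0 1"])
          show "deriv p holomorphic_on ball 0 1" using p(1) by (intro holomorphic_deriv) auto
          show "(\<lambda>\<zeta>. - q \<zeta>) holomorphic_on ball 0 1" using q by (intro holomorphic_intros)
          show "deriv p \<zeta> = - q \<zeta>" if "\<zeta> \<in> ball 0 1" for \<zeta>
            using p(3)[OF that] by (simp only: q_def)
        qed (use zj in auto)
        also have "\<dots> = - (deriv ^^ l) q (z $ j)"
          using q zj by (intro higher_deriv_uminus[of _ "ball 0 1"]) auto
        finally have "cmod ((deriv ^^ l) q (z $ j)) = cmod ((deriv ^^ m j) p (z $ j))" by simp
        also have "\<dots> \<le> 2 * Re (p (z $ j)) * (fact (m j) * disc_factor (m j) (cmod (z $ j)))"
          using p z le zj mj by (intro higher_deriv_le_Re) auto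
        finally show ?thesis
          using pair(3)[OF z] p(2)[of "z $ j"] zj unfolding a' b' \<beta> \<beta>1 by (simp add: q_def[abs_def])
      qed
      then show ?thesis using pair(1,2) by (simp add: a' b' \<beta>_def)
    qed
  qed
qed simp

section \<open>Symmetry of the second derivative\<close>

text \<open>
  The second difference of \<open>f\<close> is the increment over \<open>t \<in> [0,1]\<close> of
  \<open>f (x + s h + t s k) - f (x + t s k)\<close>.  Its \<open>t\<close>-derivative is \<open>s\<close> times the difference of two
  values of \<open>D1\<close> in the direction \<open>k\<close>; the linear approximation of \<open>D1\<close> at \<open>x\<close> replaces this by
  \<open>s^2 D2 h k\<close> up to the stated error.
\<close>

lemma second_difference_estimate:
  fixes f :: "'a::real_normed_vector \<Rightarrow> 'b::real_normed_vector" and D1 :: "'a \<Rightarrow> 'a \<Rightarrow>\<^sub>L 'b"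
    and D2 :: "'a \<Rightarrow>\<^sub>L 'a \<Rightarrow>\<^sub>L 'b"
  assumes f: "\<And>y. y \<in> ball x d \<Longrightarrow> (f has_derivative blinfun_apply (D1 y)) (at y)"
    and e: "\<And>y. y \<in> ball x d \<Longrightarrow> norm (D1 y - D1 x - D2 (y - x)) \<le> e * norm (y - x)" "0 \<le> e"
    and s: "0 < s" "s * (norm h + norm k) < d"
  shows "norm (f (x + s *\<^sub>R h + s *\<^sub>R k) - f (x + s *\<^sub>R h) - f (x + s *\<^sub>R k) + f x - s\<^sup>2 *\<^sub>R D2 h k)
    \<le> 2 * e * s\<^sup>2 * (norm h + norm k) * norm k"
proof -
  define \<phi> where "\<phi> t = f (x + s *\<^sub>R h + (t * s) *\<^sub>R k) - f (x + (t * s) *\<^sub>R k) - (t * s\<^sup>2) *\<^sub>R D2 h k" for t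
  define E where "E y = D1 y - D1 x - D2 (y - x)" for y
  have small: "norm (s *\<^sub>R u + (t * s) *\<^sub>R k) \<le> s * (norm u + norm k)"
    if "t \<in> {0..1}" for t u
  proof -
    have "norm (s *\<^sub>R u + (t * s) *\<^sub>R k) \<le> s * norm u + t * (s * norm k)"
      using norm_triangle_ineq[of "s *\<^sub>R u" "(t * s) *\<^sub>R k"] that s(1) by (simp add: abs_mult mult.assoc)
    also have "t * (s * norm k) \<le> 1 * (s * norm k)"
      using that s(1) by (intro mult_right_mono) auto
    finally show ?thesis by (simp add: algebra_simps)
  qed
  have d: "dist x (x + u) = norm u" for u by (simp add: dist_norm)
  have inb: "x + s *\<^sub>R h + (t * s) *\<^sub>R k \<in> ball x d" "x + (t * s) *\<^sub>R k \<in> ball x d"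
    if "t \<in> {0..1}" for t
  proof -
    have "s * (norm 0 + norm k) \<le> s * (norm h + norm k)" using s(1) by (intro mult_left_mono) auto
    then show "x + s *\<^sub>R h + (t * s) *\<^sub>R k \<in> ball x d" "x + (t * s) *\<^sub>R k \<in> ball x d"
      using small[OF that, of h] small[OF that, of 0] s(2)
      by (simp_all add: d add.assoc)
  qed
  define \<phi>' where "\<phi>' t \<tau> = \<tau> *\<^sub>R s *\<^sub>R blinfun_apply (E (x + s *\<^sub>R h + (t * s) *\<^sub>R k) - E (x + (t * s) *\<^sub>R k)) k"
    for t \<tau> :: real
  have "norm (\<phi> 1 - \<phi> 0) \<le> (2 * e * s\<^sup>2 * (norm h + norm k) * norm k) * norm (1 - 0 :: real)"
  proof (rule differentiable_bound[of "{0..1}" \<phi> \<phi>'])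
    fix t :: real assume t: "t \<in> {0..1}"
    note f1 = f[OF inb(1)[OF t]] and f2 = f[OF inb(2)[OF t]]
    have "(\<phi> has_derivative (\<lambda>\<tau>. D1 (x + s *\<^sub>R h + (t * s) *\<^sub>R k) ((\<tau> * s) *\<^sub>R k)
        - D1 (x + (t * s) *\<^sub>R k) ((\<tau> * s) *\<^sub>R k) - (\<tau> * s\<^sup>2) *\<^sub>R D2 h k)) (at t)"
      unfolding \<phi>_def
      by (intro derivative_intros has_derivative_compose[where g = f and f = "\<lambda>t. x + s *\<^sub>R h + (t * s) *\<^sub>R k", OF _ f1]
          has_derivative_compose[where g = f and f = "\<lambda>t. x + (t * s) *\<^sub>R k", OF _ f2])
        (auto intro!: derivative_eq_intros)
    also have "(\<lambda>\<tau>. D1 (x + s *\<^sub>R h + (t * s) *\<^sub>R k) ((\<tau> * s) *\<^sub>R k)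
        - D1 (x + (t * s) *\<^sub>R k) ((\<tau> * s) *\<^sub>R k) - (\<tau> * s\<^sup>2) *\<^sub>R D2 h k) = \<phi>' t"
      unfolding \<phi>'_def E_def
      by (rule ext) (simp add: blinfun.bilinear_simps algebra_simps power2_eq_square)
    finally show "(\<phi> has_derivative \<phi>' t) (at t within {0..1})"
      by (rule has_derivative_at_withinI)
    have "norm (E (x + s *\<^sub>R h + (t * s) *\<^sub>R k)) \<le> e * (s * (norm h + norm k))"
      unfolding E_def using small[OF t, of h] e(2)
      by (intro order_trans[OF e(1)[OF inb(1)[OF t]]] mult_left_mono) (auto simp: add.assoc)
    moreover have "norm (E (x + (t * s) *\<^sub>R k)) \<le> e * (s * (norm 0 + norm k))"
      unfolding E_def using small[OF t, of 0] e(2)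
      by (intro order_trans[OF e(1)[OF inb(2)[OF t]]] mult_left_mono) auto
    moreover have "e * (s * (norm 0 + norm k)) \<le> e * (s * (norm h + norm k))"
      using s(1) e(2) by (intro mult_left_mono) auto
    ultimately have E: "norm (E (x + s *\<^sub>R h + (t * s) *\<^sub>R k) - E (x + (t * s) *\<^sub>R k))
        \<le> 2 * (e * (s * (norm h + norm k)))"
      using norm_triangle_ineq4 order_trans by (smt (verit))
    show "onorm (\<phi>' t) \<le> 2 * e * s\<^sup>2 * (norm h + norm k) * norm k"
    proof (rule onorm_le)
      fix \<tau> :: real
      let ?E = "E (x + s *\<^sub>R h + (t * s) *\<^sub>R k) - E (x + (t * s) *\<^sub>R k)"
      have "norm (\<phi>' t \<tau>) = \<bar>\<tau>\<bar> * (s * norm (blinfun_apply ?E k))"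
        using s(1) by (simp add: \<phi>'_def abs_mult)
      also have "\<dots> \<le> \<bar>\<tau>\<bar> * (s * (2 * (e * (s * (norm h + norm k))) * norm k))"
        using s(1) E by (intro mult_left_mono order_trans[OF norm_blinfun] mult_right_mono) auto
      finally show "norm (\<phi>' t \<tau>) \<le> 2 * e * s\<^sup>2 * (norm h + norm k) * norm k * norm \<tau>"
        by (simp add: power2_eq_square mult_ac)
    qed
  qed auto
  also have "\<phi> 1 - \<phi> 0 = f (x + s *\<^sub>R h + s *\<^sub>R k) - f (x + s *\<^sub>R h) - f (x + s *\<^sub>R k) + f x - s\<^sup>2 *\<^sub>R D2 h k"
    by (simp add: \<phi>_def)
  finally show ?thesis by simp
qed

text \<open>
  The second difference is symmetric in \<open>h\<close> and \<open>k\<close>, and approximates both \<open>s^2 D2 h k\<close> and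
  \<open>s^2 D2 k h\<close> up to an arbitrarily small multiple of \<open>s^2\<close>.
\<close>

lemma second_derivative_symmetric:
  fixes f :: "'a::real_normed_vector \<Rightarrow> 'b::real_normed_vector" and D1 :: "'a \<Rightarrow> 'a \<Rightarrow>\<^sub>L 'b"
    and D2 :: "'a \<Rightarrow>\<^sub>L 'a \<Rightarrow>\<^sub>L 'b"
  assumes S: "open S" "x \<in> S" and f: "\<And>y. y \<in> S \<Longrightarrow> (f has_derivative blinfun_apply (D1 y)) (at y)"
    and D: "(D1 has_derivative blinfun_apply D2) (at x)"
  shows "D2 h k = D2 k h"
proof -
  define M where "M = norm h + norm k"
  have M0: "0 \<le> M" by (simp add: M_def)
  have "norm (D2 h k - D2 k h) \<le> \<epsilon>" if \<epsilon>: "0 < \<epsilon>" for \<epsilon>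
  proof -
    \<comment> \<open>Divided by \<open>s\<^sup>2\<close>, the two error terms add up to \<open>2 * e * M\<^sup>2\<close>; the \<open>1\<close> guards against \<open>M = 0\<close>.\<close>
    define e where "e = \<epsilon> / (2 * M\<^sup>2 + 1)"
    have M1: "0 < 2 * M\<^sup>2 + 1" by (simp add: add_nonneg_pos)
    from \<epsilon> M1 have e: "0 < e" unfolding e_def by (rule divide_pos_pos)
    obtain d1 where d1: "0 < d1" "\<And>y. norm (y - x) < d1 \<Longrightarrow> norm (D1 y - D1 x - D2 (y - x)) \<le> e * norm (y - x)"
      using D e unfolding has_derivative_at_alt by blast
    obtain d2 where d2: "0 < d2" "ball x d2 \<subseteq> S" using S openE by blast
    define d where "d = min d1 d2"
    have d: "0 < d" using d1 d2 by (simp add: d_def)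
    define s where "s = d / (M + 1)"
    have s: "0 < s" "s * M < d" using d M0 by (simp_all add: s_def field_simps)
    have inS: "y \<in> S \<and> norm (y - x) < d1" if "y \<in> ball x d" for y
      using that d2 by (auto simp: d_def dist_norm norm_minus_commute)
    have f': "(f has_derivative blinfun_apply (D1 y)) (at y)"
      and e': "norm (D1 y - D1 x - D2 (y - x)) \<le> e * norm (y - x)" if "y \<in> ball x d" for y
      using f d1(2) inS[OF that] by auto
    let ?\<Delta> = "f (x + s *\<^sub>R h + s *\<^sub>R k) - f (x + s *\<^sub>R h) - f (x + s *\<^sub>R k) + f x"
    have 1: "norm (?\<Delta> - s\<^sup>2 *\<^sub>R D2 h k) \<le> 2 * e * s\<^sup>2 * (norm h + norm k) * norm k"
      by (rule second_difference_estimate[OF f' e']) (use e s in \<open>auto simp: M_def\<close>)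
    have "norm (f (x + s *\<^sub>R k + s *\<^sub>R h) - f (x + s *\<^sub>R k) - f (x + s *\<^sub>R h) + f x - s\<^sup>2 *\<^sub>R D2 k h)
        \<le> 2 * e * s\<^sup>2 * (norm k + norm h) * norm h"
      by (rule second_difference_estimate[OF f' e']) (use e s in \<open>auto simp: M_def add.commute\<close>)
    also have "f (x + s *\<^sub>R k + s *\<^sub>R h) - f (x + s *\<^sub>R k) - f (x + s *\<^sub>R h) + f x = ?\<Delta>"
      by (simp add: algebra_simps)
    finally have 2: "norm (?\<Delta> - s\<^sup>2 *\<^sub>R D2 k h) \<le> 2 * e * s\<^sup>2 * (norm k + norm h) * norm h" .
    have "s\<^sup>2 * norm (D2 h k - D2 k h) = norm ((?\<Delta> - s\<^sup>2 *\<^sub>R D2 k h) - (?\<Delta> - s\<^sup>2 *\<^sub>R D2 h k))"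
      by (simp add: scaleR_diff_right[symmetric])
    also have "\<dots> \<le> 2 * e * s\<^sup>2 * (norm k + norm h) * norm h + 2 * e * s\<^sup>2 * (norm h + norm k) * norm k"
      using norm_triangle_ineq4 1 2 by (smt (verit))
    also have "\<dots> = s\<^sup>2 * (2 * e * M\<^sup>2)" by (simp add: M_def algebra_simps power2_eq_square)
    finally have "norm (D2 h k - D2 k h) \<le> 2 * e * M\<^sup>2" using s(1) by simp
    also have "\<dots> = \<epsilon> * (2 * M\<^sup>2 / (2 * M\<^sup>2 + 1))" by (simp add: e_def)
    also have "\<dots> \<le> \<epsilon> * 1" using \<epsilon> M1 by (intro mult_left_mono) (auto simp: divide_le_eq)
    finally show ?thesis by simp
  qed
  then show ?thesis using field_le_epsilon[of "norm (D2 h k - D2 k h)" 0] by simp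
qed

section \<open>First derivatives of pluriharmonic functions\<close>

lemma dir_deriv_blinfun:
  assumes "(f has_derivative blinfun_apply D) (at w)"
  shows "dir_deriv v f w = D v"
proof -
  have "((\<lambda>t. f (w + t *\<^sub>R v)) has_derivative (\<lambda>t. D (t *\<^sub>R v))) (at 0)"
    by (rule has_derivative_compose[where g = f]) (use assms in \<open>auto intro!: derivative_eq_intros\<close>)
  then show ?thesis
    unfolding dir_deriv_def
    by (intro vector_derivative_at) (simp add: has_vector_derivative_def blinfun.scaleR_right)
qed

text \<open>
  On the complex line through \<open>z\<close> in the direction \<open>\<theta>\<close>, the Laplace equation at \<open>z\<close> reads
  \<open>D2 \<theta> \<theta> + D2 (\<i> \<theta>) (\<i> \<theta>) = 0\<close>.  It extends from unit vectors to all \<open>\<theta>\<close> by scaling, and to the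
  bilinear form by polarization, where symmetry of \<open>D2\<close> is used.
\<close>

lemma pluriharmonic_second_derivative:
  fixes f :: "complex ^ 'n \<Rightarrow> complex"
    and D1 :: "complex ^ 'n \<Rightarrow> (complex ^ 'n) \<Rightarrow>\<^sub>L complex" and D2
  assumes ph: "pluriharmonic_on S f" and S: "open S" and zS: "z \<in> S"
    and f: "\<And>y. y \<in> S \<Longrightarrow> (f has_derivative blinfun_apply (D1 y)) (at y)"
    and D: "(D1 has_derivative blinfun_apply D2) (at z)"
  shows "D2 h k + D2 (\<i> *s h) (\<i> *s k) = 0"
proof -
  have second: "dir_deriv v (dir_deriv v (\<lambda>\<zeta>. f (z + \<zeta> *s \<theta>))) 0 = D2 (v *s \<theta>) (v *s \<theta>)" for v \<theta>
  proof -
    have first: "dir_deriv v (\<lambda>\<zeta>. f (z + \<zeta> *s \<theta>)) \<zeta> = D1 (z + \<zeta> *s \<theta>) (v *s \<theta>)"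
      if "z + \<zeta> *s \<theta> \<in> S" for \<zeta>
    proof -
      have "dir_deriv v (\<lambda>\<zeta>. f (z + \<zeta> *s \<theta>)) \<zeta> = dir_deriv (v *s \<theta>) f (z + \<zeta> *s \<theta>)"
        unfolding dir_deriv_def
        by (rule arg_cong[where f = "\<lambda>g. vector_derivative g _"], rule ext, rule arg_cong[where f = f])
          (simp add: vec_eq_iff algebra_simps)
      then show ?thesis using dir_deriv_blinfun[OF f[OF that]] by simp
    qed
    have "(\<lambda>t. z + t *\<^sub>R (v *s \<theta>)) \<midarrow>0\<rightarrow> z + 0 *\<^sub>R (v *s \<theta>)" by (intro tendsto_intros)
    then have "((\<lambda>t. z + t *\<^sub>R (v *s \<theta>)) \<longlongrightarrow> z) (nhds 0)"
      by (simp add: tendsto_nhds_iff)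
    then have ev: "\<forall>\<^sub>F t in nhds 0. z + t *\<^sub>R (v *s \<theta>) \<in> S"
      using S zS by (auto dest: topological_tendstoD)
    have eq: "z + t *\<^sub>R (v *s \<theta>) = z + (0 + t *\<^sub>R v) *s \<theta>" for t
      by (simp add: vec_eq_iff)
    have "vector_derivative (\<lambda>t. dir_deriv v (\<lambda>\<zeta>. f (z + \<zeta> *s \<theta>)) (0 + t *\<^sub>R v)) (at 0)
        = vector_derivative (\<lambda>t. D1 (z + t *\<^sub>R (v *s \<theta>)) (v *s \<theta>)) (at 0)"
      by (rule vector_derivative_cong_eq)
        (use ev in \<open>auto simp: first eq simp del: add_0 elim!: eventually_mono\<close>)
    also have "((\<lambda>t. D1 (z + t *\<^sub>R (v *s \<theta>)) (v *s \<theta>)) has_derivative (\<lambda>t. D2 (t *\<^sub>R (v *s \<theta>)) (v *s \<theta>))) (at 0)"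
      by (rule bounded_linear.has_derivative[OF blinfun.bounded_linear_left], rule has_derivative_compose[where g = D1])
        (use D in \<open>auto intro!: derivative_eq_intros\<close>)
    then have "vector_derivative (\<lambda>t. D1 (z + t *\<^sub>R (v *s \<theta>)) (v *s \<theta>)) (at 0) = D2 (v *s \<theta>) (v *s \<theta>)"
      by (intro vector_derivative_at) (simp add: has_vector_derivative_def blinfun.bilinear_simps)
    finally show ?thesis by (simp add: dir_deriv_def)
  qed
  have unit: "D2 \<theta> \<theta> + D2 (\<i> *s \<theta>) (\<i> *s \<theta>) = 0" if "norm \<theta> = 1" for \<theta>
  proof -
    have "frontier S = {} \<or> 0 < infdist z (frontier S)"
      using S zS by (auto simp: frontier_def interior_open intro!: infdist_pos_not_in_closed)
    then have "dir_deriv 1 (dir_deriv 1 (\<lambda>\<zeta>. f (z + \<zeta> *s \<theta>))) 0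
        + dir_deriv \<i> (dir_deriv \<i> (\<lambda>\<zeta>. f (z + \<zeta> *s \<theta>))) 0 = 0"
      using ph zS that unfolding pluriharmonic_on_def harmonic_on_def by auto
    then show ?thesis by (simp add: second)
  qed
  have diag: "D2 \<theta> \<theta> + D2 (\<i> *s \<theta>) (\<i> *s \<theta>) = 0" for \<theta>
  proof (cases "\<theta> = 0")
    case False
    define u where "u = \<theta> /\<^sub>R norm \<theta>"
    have u: "norm u = 1" "\<theta> = norm \<theta> *\<^sub>R u" "\<i> *s \<theta> = norm \<theta> *\<^sub>R (\<i> *s u)"
      using False by (auto simp: u_def vec_eq_iff)
    have "D2 \<theta> \<theta> + D2 (\<i> *s \<theta>) (\<i> *s \<theta>)
        = (norm \<theta>)\<^sup>2 *\<^sub>R (D2 u u + D2 (\<i> *s u) (\<i> *s u))"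
      by (subst u(3), subst u(3), subst u(2), subst u(2))
        (simp add: blinfun.bilinear_simps power2_eq_square scaleR_add_right del: norm_scaleR)
    then show ?thesis using unit[OF u(1)] by simp
  qed simp
  have sym: "D2 a b = D2 b a" for a b
    by (rule second_derivative_symmetric[OF S zS f D])
  have "\<i> *s (h + k) = \<i> *s h + \<i> *s k" by (simp add: vec_eq_iff algebra_simps)
  then have "(D2 h h + D2 (\<i> *s h) (\<i> *s h)) + (D2 k k + D2 (\<i> *s k) (\<i> *s k))
      + 2 * (D2 h k + D2 (\<i> *s h) (\<i> *s k)) = 0"
    using diag[of "h + k"] sym[of k h] sym[of "\<i> *s k" "\<i> *s h"]
    by (simp add: blinfun.bilinear_simps algebra_simps)
  then have "2 * (D2 h k + D2 (\<i> *s h) (\<i> *s k)) = 0"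
    unfolding diag by simp
  then show ?thesis by (metis mult_eq_0_iff zero_neq_numeral)
qed

text \<open>
  The polarized Laplace equation for \<open>(h, k)\<close> and \<open>(h, \<i> k)\<close> is the Cauchy--Riemann equation in the
  direction \<open>h\<close> for \<open>\<partial>f/\<partial>z_j\<close>.  The real-linear map \<open>c\<close> is the identity for \<open>\<partial>f/\<partial>z_j\<close>, and
  conjugation for the conjugate of \<open>\<partial>f/\<partial>cnj z_j\<close>, which is \<open>\<partial>(cnj f)/\<partial>z_j\<close>.
\<close>

lemma sep_holo_first_derivative:
  fixes D1 :: "complex ^ 'n \<Rightarrow> (complex ^ 'n) \<Rightarrow>\<^sub>L complex"
  assumes c: "bounded_linear c"
    and D: "\<And>z. z \<in> unit_polydisc \<Longrightarrow> (D1 has_derivative blinfun_apply (D2 z)) (at z)"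
    and L: "\<And>z h k. z \<in> unit_polydisc \<Longrightarrow> D2 z h k + D2 z (\<i> *s h) (\<i> *s k) = 0"
  shows "sep_holo (\<lambda>w. (c (D1 w (axis j 1)) - \<i> * c (D1 w (axis j \<i>))) / 2)"
proof -
  interpret c: bounded_linear c by (rule c)
  define \<psi> where "\<psi> w = (c (D1 w (axis j 1)) - \<i> * c (D1 w (axis j \<i>))) / 2" for w
  define \<psi>' where "\<psi>' z h = (c (D2 z h (axis j 1)) - \<i> * c (D2 z h (axis j \<i>))) / 2" for z h
  have d: "(\<psi> has_derivative \<psi>' z) (at z)" if "z \<in> unit_polydisc" for z
  proof -
    have "((\<lambda>w. c (D1 w a)) has_derivative (\<lambda>h. c (D2 z h a))) (at z)" for a
      by (intro bounded_linear.has_derivative[OF c]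
          bounded_linear.has_derivative[OF blinfun.bounded_linear_left] D[OF that])
    then show ?thesis
      unfolding \<psi>_def \<psi>'_def
      by (intro bounded_linear.has_derivative[OF bounded_linear_divide] has_derivative_diff
          has_derivative_mult_right)
  qed
  have ii: "\<i> *s axis j \<i> = - (axis j (1::complex) :: complex ^ 'n)"
    "\<i> *s axis j 1 = (axis j \<i> :: complex ^ 'n)" for j
    by (simp_all add: vec_eq_iff axis_def)
  have lin: "\<psi>' z (axis k h) = \<psi>' z (axis k 1) * h" if z: "z \<in> unit_polydisc" for z k h
  proof -
    interpret l: bounded_linear "\<psi>' z" using d[OF z] by (rule has_derivative_bounded_linear)
    have 1: "D2 z (axis k \<i>) (axis j \<i>) = - D2 z (axis k 1) (axis j 1)"
      using L[OF z, of "axis k 1" "axis j 1"] by (simp add: ii eq_neg_iff_add_eq_0 add.commute)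
    have 2: "D2 z (axis k \<i>) (axis j 1) = D2 z (axis k 1) (axis j \<i>)"
      using L[OF z, of "axis k 1" "axis j \<i>"] by (simp add: ii blinfun.minus_right)
    have "\<psi>' z (axis k h) = Re h *\<^sub>R \<psi>' z (axis k 1) + Im h *\<^sub>R \<psi>' z (axis k \<i>)"
      by (subst axis_complex_decompose) (simp only: l.add l.scaleR)
    also have "\<psi>' z (axis k \<i>) = \<i> * \<psi>' z (axis k 1)"
      unfolding \<psi>'_def 1 2 by (simp add: c.neg algebra_simps)
    also have "Re h *\<^sub>R \<psi>' z (axis k 1) + Im h *\<^sub>R (\<i> * \<psi>' z (axis k 1)) = \<psi>' z (axis k 1) * h"
      by (simp add: complex_eq_iff algebra_simps)
    finally show ?thesis .
  qed
  have "sep_holo \<psi>"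
  proof (rule sep_holo_isContI)
    fix z :: "complex ^ 'n" assume z: "z \<in> unit_polydisc"
    show "isCont \<psi> z" using d[OF z] by (rule has_derivative_continuous)
    fix k
    show "(\<lambda>\<zeta>. \<psi> (vec_upd z k \<zeta>)) holomorphic_on ball 0 1"
    proof (subst holomorphic_on_open[OF open_ball], intro ballI)
      fix \<zeta> :: complex assume "\<zeta> \<in> ball 0 1"
      then have P: "vec_upd z k \<zeta> \<in> unit_polydisc" using z by simp
      have eq: "(\<lambda>h. \<psi>' (vec_upd z k \<zeta>) (axis k h)) = (*) (\<psi>' (vec_upd z k \<zeta>) (axis k 1))"
        using lin[OF P] by (rule ext)
      have "((\<lambda>\<zeta>. \<psi> (vec_upd z k \<zeta>)) has_derivative (\<lambda>h. \<psi>' (vec_upd z k \<zeta>) (axis k h))) (at \<zeta>)"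
        by (rule has_derivative_compose[OF has_derivative_vec_upd d[OF P]])
      then show "\<exists>f'. ((\<lambda>\<zeta>. \<psi> (vec_upd z k \<zeta>)) has_field_derivative f') (at \<zeta>)"
        unfolding has_field_derivative_def eq by (rule exI)
    qed
  qed
  then show ?thesis by (simp only: \<psi>_def[abs_def])
qed

text \<open>
  On a slice in the coordinate \<open>j\<close>, the sum of \<open>\<partial>f/\<partial>z_j\<close> and the conjugate of \<open>\<partial>f/\<partial>cnj z_j\<close>
  is \<open>2 \<partial>(Re f)/\<partial>z_j\<close>, so a primitive of it has real part \<open>Re f\<close> up to a constant.
\<close>

lemma pluriharmonic_mixed_bound:
  fixes f :: "complex ^ 'n \<Rightarrow> complex" and m :: "'n \<Rightarrow> nat"
  assumes ph: "pluriharmonic_on unit_polydisc f"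
    and le: "\<And>w. w \<in> unit_polydisc \<Longrightarrow> Re (f w) \<le> 1"
    and xs: "distinct xs" "\<exists>j\<in>set xs. m j \<noteq> 0" and z: "z \<in> unit_polydisc"
  shows "cmod (foldr (\<lambda>j. wirtinger j ^^ m j) xs f z + cnj (foldr (\<lambda>j. wirtinger_bar j ^^ m j) xs f z))
    \<le> 2 * (1 - Re (f z)) * (\<Prod>j\<in>set xs. fact (m j) * disc_factor (m j) (cmod (z $ j)))"
proof -
  obtain D1 :: "complex ^ 'n \<Rightarrow> (complex ^ 'n) \<Rightarrow>\<^sub>L complex" and D2
    where D1: "\<And>x. x \<in> unit_polydisc \<Longrightarrow> (f has_derivative blinfun_apply (D1 x)) (at x)"
    and D2: "\<And>x. x \<in> unit_polydisc \<Longrightarrow> (D1 has_derivative blinfun_apply (D2 x)) (at x)"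
    using ph unfolding pluriharmonic_on_def C2_on_def by blast
  have L: "D2 z h k + D2 z (\<i> *s h) (\<i> *s k) = 0" if "z \<in> unit_polydisc" for z h k
    by (rule pluriharmonic_second_derivative[OF ph open_unit_polydisc that D1 D2[OF that]])
  have W: "wirtinger j f w = (D1 w (axis j 1) - \<i> * D1 w (axis j \<i>)) / 2"
    "cnj (wirtinger_bar j f w) = (cnj (D1 w (axis j 1)) - \<i> * cnj (D1 w (axis j \<i>))) / 2"
    if "w \<in> unit_polydisc" for w j
    by (simp_all add: wirtinger_def wirtinger_bar_def dir_deriv_blinfun[OF D1[OF that]])
  have hW: "sep_holo (wirtinger j f)" for j
    by (rule sep_holo_cong[OF _ sep_holo_first_derivative[OF bounded_linear_ident D2 L, of j]])
      (simp add: W)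
  have hWb: "sep_holo (\<lambda>w. cnj (wirtinger_bar j f w))" for j
    by (rule sep_holo_cong[OF _ sep_holo_first_derivative[OF bounded_linear_cnj D2 L, of j]])
      (simp add: W)
  have prim: "\<exists>p. p holomorphic_on ball 0 1 \<and>
      (\<forall>\<zeta>\<in>ball 0 1. Re (p \<zeta>) = 1 - Re (f (vec_upd z j \<zeta>)) \<and>
        deriv p \<zeta> = - (wirtinger j f (vec_upd z j \<zeta>) + cnj (wirtinger_bar j f (vec_upd z j \<zeta>))))"
    if z: "z \<in> unit_polydisc" for z j
  proof -
    define g where "g \<zeta> = - (wirtinger j f (vec_upd z j \<zeta>) + cnj (wirtinger_bar j f (vec_upd z j \<zeta>)))" for \<zeta>
    have "g holomorphic_on ball 0 1"
      unfolding g_def[abs_def] by (intro holomorphic_intros sep_holo_slice[OF _ z] hW hWb)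
    then obtain p where p: "\<And>\<zeta>. \<zeta> \<in> ball 0 1 \<Longrightarrow> (p has_field_derivative g \<zeta>) (at \<zeta> within ball 0 1)"
      using holomorphic_convex_primitive'[of "ball 0 1" g] by auto
    then have p': "(p has_field_derivative g \<zeta>) (at \<zeta>)" if "\<zeta> \<in> ball 0 1" for \<zeta>
      using that by (metis at_within_open open_ball)
    have "\<exists>c. \<forall>\<zeta>\<in>ball 0 1. Re (p \<zeta>) + Re (f (vec_upd z j \<zeta>)) = c"
    proof (rule has_derivative_zero_constant)
      fix \<zeta> :: complex assume \<zeta>: "\<zeta> \<in> ball 0 1"
      then have P: "vec_upd z j \<zeta> \<in> unit_polydisc" using z by simp
      have "((\<lambda>\<zeta>. Re (p \<zeta>) + Re (f (vec_upd z j \<zeta>))) has_derivative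
          (\<lambda>h. Re (g \<zeta> * h) + Re (D1 (vec_upd z j \<zeta>) (axis j h)))) (at \<zeta>)"
        using p'[OF \<zeta>] unfolding has_field_derivative_def
        by (intro has_derivative_add bounded_linear.has_derivative[OF bounded_linear_Re]
            has_derivative_compose[OF has_derivative_vec_upd D1[OF P]])
      also have "(\<lambda>h. Re (g \<zeta> * h) + Re (D1 (vec_upd z j \<zeta>) (axis j h))) = (\<lambda>h. 0)"
        by (rule ext, subst axis_complex_decompose)
          (simp add: g_def W[OF P] blinfun.bilinear_simps field_simps)
      finally show "((\<lambda>\<zeta>. Re (p \<zeta>) + Re (f (vec_upd z j \<zeta>))) has_derivative (\<lambda>h. 0)) (at \<zeta> within ball 0 1)"
        by (rule has_derivative_at_withinI)
    qed simp
    then obtain c where c: "\<And>\<zeta>. \<zeta> \<in> ball 0 1 \<Longrightarrow> Re (p \<zeta>) + Re (f (vec_upd z j \<zeta>)) = c" by blast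
    define P where "P \<zeta> = p \<zeta> + of_real (1 - c)" for \<zeta>
    have P': "(P has_field_derivative g \<zeta>) (at \<zeta>)" if "\<zeta> \<in> ball 0 1" for \<zeta>
      unfolding P_def using p'[OF that] by (auto intro!: derivative_eq_intros)
    show ?thesis
    proof (intro exI[of _ P] conjI ballI)
      show "P holomorphic_on ball 0 1" using P' unfolding holomorphic_on_open[OF open_ball] by blast
      fix \<zeta> :: complex assume \<zeta>: "\<zeta> \<in> ball 0 1"
      show "Re (P \<zeta>) = 1 - Re (f (vec_upd z j \<zeta>))" using c[OF \<zeta>] by (simp add: P_def)
      show "deriv P \<zeta> = - (wirtinger j f (vec_upd z j \<zeta>) + cnj (wirtinger_bar j f (vec_upd z j \<zeta>)))"
        using DERIV_imp_deriv[OF P'[OF \<zeta>]] by (simp only: g_def)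
    qed
  qed
  show ?thesis
    using mixed_bound[of f xs m, OF hW hWb prim le xs] z by blast
qed

section \<open>The inequality\<close>

text \<open>
  The factors increase with \<open>t\<close>, so every \<open>\<bar>z_j\<bar>\<close> may be replaced by the maximum norm; the exponents
  \<open>m_j - 1\<close> over the support of \<open>m\<close> add up to \<open>\<bar>m\<bar> - N\<close>.
\<close>

lemma mixed_deriv_bound:
  fixes f :: "(complex, 'n::{finite,linorder}) vec \<Rightarrow> complex"
  assumes ph: "pluriharmonic_on unit_polydisc f"
    and le: "\<And>w. w \<in> unit_polydisc \<Longrightarrow> Re (f w) \<le> 1"
    and z: "z \<in> unit_polydisc" and m: "m \<noteq> (\<lambda>_. 0)"
  shows "cmod (mixed_deriv wirtinger m f z + cnj (mixed_deriv wirtinger_bar m f z))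
    \<le> 2 * mi_fact m * (1 - Re (f z)) *
      ((1 + linf_norm z) ^ (mi_size m - mi_supp_card m) / (1 - (linf_norm z)\<^sup>2) ^ mi_size m)"
proof -
  define t where "t = linf_norm z"
  have t: "0 \<le> t" "t < 1"
    using z order_trans[OF norm_ge_zero nth_le_linf_norm[of z undefined]]
    by (auto simp: t_def unit_polydisc_def)
  have "cmod (mixed_deriv wirtinger m f z + cnj (mixed_deriv wirtinger_bar m f z))
    \<le> 2 * (1 - Re (f z)) * (\<Prod>j\<in>UNIV. fact (m j) * disc_factor (m j) (cmod (z $ j)))"
    using pluriharmonic_mixed_bound[OF ph le _ _ z, of "sorted_list_of_set UNIV" m] m
    by (simp add: mixed_deriv_def fun_eq_iff)
  also have "\<dots> \<le> 2 * (1 - Re (f z)) * (\<Prod>j\<in>UNIV. fact (m j) * disc_factor (m j) t)"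
  proof (intro mult_left_mono prod_mono conjI)
    fix j
    define s where "s = cmod (z $ j)"
    have s: "0 \<le> s" "s \<le> t" using nth_le_linf_norm[of z j] by (auto simp: s_def t_def)
    have sq: "s\<^sup>2 \<le> t\<^sup>2" "t\<^sup>2 < 1" using s t by (auto intro: power_mono simp: power_less_one_iff)
    then have s1: "s\<^sup>2 \<le> 1" by linarith
    show "disc_factor (m j) (cmod (z $ j)) \<le> disc_factor (m j) t"
      unfolding disc_factor_def s_def[symmetric] using s t sq by (intro frac_le power_mono zero_less_power) auto
    show "0 \<le> fact (m j) * disc_factor (m j) (cmod (z $ j))"
      unfolding disc_factor_def s_def[symmetric] using s s1
      by (intro mult_nonneg_nonneg divide_nonneg_nonneg zero_le_power) auto
  qed (use le[OF z] in auto)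
  also have "(\<Prod>j\<in>UNIV. fact (m j) * disc_factor (m j) t)
      = mi_fact m * ((1 + t) ^ (\<Sum>j\<in>UNIV. m j - 1) / (1 - t\<^sup>2) ^ mi_size m)"
    by (simp add: disc_factor_def prod.distrib prod_dividef power_sum mi_fact_def mi_size_def)
  also have "(\<Sum>j\<in>UNIV. m j - 1) = mi_size m - mi_supp_card m"
  proof -
    have "mi_size m = (\<Sum>j\<in>UNIV. (m j - 1) + (if m j \<noteq> 0 then 1 else 0))"
      unfolding mi_size_def by (intro sum.cong) auto
    also have "\<dots> = (\<Sum>j\<in>UNIV. m j - 1) + mi_supp_card m"
      by (simp add: sum.distrib mi_supp_card_def sum.If_cases)
    finally show ?thesis by simp
  qed
  finally show ?thesis by (simp add: t_def mult_ac)
qed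

section \<open>Calculus of continuously differentiable functions\<close>

text \<open>
  With the bounded linear maps as values, the derivative of a \<open>C2\<close> function is itself a \<open>C1\<close>
  function, so closure properties of \<open>C2\<close> follow from those of \<open>C1\<close> applied to the formula for the
  derivative.
\<close>

definition C1_on :: "'a::real_normed_vector set \<Rightarrow> ('a \<Rightarrow> 'b::real_normed_vector) \<Rightarrow> bool" where
  "C1_on S f \<longleftrightarrow> (\<exists>D :: 'a \<Rightarrow> 'a \<Rightarrow>\<^sub>L 'b.
    (\<forall>x\<in>S. (f has_derivative blinfun_apply (D x)) (at x)) \<and> continuous_on S D)"

lemma C2_on_iff:
  "C2_on S f \<longleftrightarrow> (\<exists>D. (\<forall>x\<in>S. (f has_derivative blinfun_apply (D x)) (at x)) \<and> C1_on S D)"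
  unfolding C2_on_def C1_on_def by blast

lemma C1_onI:
  "(\<And>x. x \<in> S \<Longrightarrow> (f has_derivative blinfun_apply (D x)) (at x)) \<Longrightarrow> continuous_on S D \<Longrightarrow> C1_on S f"
  unfolding C1_on_def by blast

lemma C2_onI:
  "(\<And>x. x \<in> S \<Longrightarrow> (f has_derivative blinfun_apply (D x)) (at x)) \<Longrightarrow> C1_on S D \<Longrightarrow> C2_on S f"
  unfolding C2_on_iff by blast

lemma C1_on_imp_continuous_on: "C1_on S f \<Longrightarrow> continuous_on S f"
  unfolding C1_on_def
  by (meson continuous_at_imp_continuous_on has_derivative_continuous)

lemma C2_on_imp_C1_on: "C2_on S f \<Longrightarrow> C1_on S f"
  unfolding C2_on_iff by (metis C1_on_def C1_on_imp_continuous_on)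

lemma C1_on_const: "C1_on S (\<lambda>_. c)"
  unfolding C1_on_def by (intro exI[of _ "\<lambda>_. 0"]) (auto simp: zero_blinfun.rep_eq)

lemma C1_on_bounded_linear:
  assumes L: "bounded_linear L" and f: "C1_on S f"
  shows "C1_on S (\<lambda>x. L (f x))"
proof -
  obtain D where D: "\<And>x. x \<in> S \<Longrightarrow> (f has_derivative blinfun_apply (D x)) (at x)" "continuous_on S D"
    using f unfolding C1_on_def by blast
  have "((\<lambda>x. L (f x)) has_derivative blinfun_apply (Blinfun L o\<^sub>L D x)) (at x)" if "x \<in> S" for x
    using bounded_linear.has_derivative[OF L D(1)[OF that]]
    by (rule has_derivative_eq_rhs) (simp add: bounded_linear_Blinfun_apply[OF L] fun_eq_iff)
  moreover have "continuous_on S (\<lambda>x. Blinfun L o\<^sub>L D x)"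
    using D(2) by (intro continuous_intros)
  ultimately show ?thesis by (rule C1_onI)
qed

lemma C1_on_add:
  assumes "C1_on S f" "C1_on S g"
  shows "C1_on S (\<lambda>x. f x + g x)"
proof -
  obtain Df Dg where D: "\<And>x. x \<in> S \<Longrightarrow> (f has_derivative blinfun_apply (Df x)) (at x)" "continuous_on S Df"
    "\<And>x. x \<in> S \<Longrightarrow> (g has_derivative blinfun_apply (Dg x)) (at x)" "continuous_on S Dg"
    using assms unfolding C1_on_def by metis
  have "((\<lambda>x. f x + g x) has_derivative blinfun_apply (Df x + Dg x)) (at x)" if "x \<in> S" for x
    using has_derivative_add[OF D(1,3)[OF that]]
    by (rule has_derivative_eq_rhs) (simp add: fun_eq_iff blinfun.add_left)
  moreover have "continuous_on S (\<lambda>x. Df x + Dg x)"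
    using D by (intro continuous_intros)
  ultimately show ?thesis by (rule C1_onI)
qed

lemma C1_on_bounded_bilinear:
  assumes B: "bounded_bilinear pr" and "C1_on S f" "C1_on S g"
  shows "C1_on S (\<lambda>x. pr (f x) (g x))"
proof -
  interpret B: bounded_bilinear pr by (rule B)
  obtain Df Dg where D: "\<And>x. x \<in> S \<Longrightarrow> (f has_derivative blinfun_apply (Df x)) (at x)" "continuous_on S Df"
    "\<And>x. x \<in> S \<Longrightarrow> (g has_derivative blinfun_apply (Dg x)) (at x)" "continuous_on S Dg"
    using assms(2,3) unfolding C1_on_def by metis
  have "((\<lambda>x. pr (f x) (g x)) has_derivative
      blinfun_apply ((B.prod_right (f x) o\<^sub>L Dg x) + (B.prod_left (g x) o\<^sub>L Df x))) (at x)" if "x \<in> S" for x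
    using B.FDERIV[OF D(1,3)[OF that]]
    by (rule has_derivative_eq_rhs) (simp add: fun_eq_iff blinfun.add_left)
  moreover have "continuous_on S (\<lambda>x. (B.prod_right (f x) o\<^sub>L Dg x) + (B.prod_left (g x) o\<^sub>L Df x))"
    using D(2,4) C1_on_imp_continuous_on[OF assms(2)] C1_on_imp_continuous_on[OF assms(3)]
    by (intro continuous_intros bounded_linear.continuous_on[OF B.bounded_linear_prod_right]
      bounded_linear.continuous_on[OF B.bounded_linear_prod_left])
  ultimately show ?thesis by (rule C1_onI)
qed

lemma C2_on_const: "C2_on S (\<lambda>_. c)"
  unfolding C2_on_iff by (intro exI[of _ "\<lambda>_. 0"]) (auto simp: zero_blinfun.rep_eq intro: C1_on_const)

lemma C2_on_bounded_linear:
  assumes L: "bounded_linear L"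
  shows "C2_on S L"
  unfolding C2_on_iff
  by (intro exI[of _ "\<lambda>_. Blinfun L"] conjI ballI C1_on_const)
    (simp add: bounded_linear_Blinfun_apply[OF L] bounded_linear_imp_has_derivative[OF L])

lemma C2_on_add:
  assumes "C2_on S f" "C2_on S g"
  shows "C2_on S (\<lambda>x. f x + g x)"
proof -
  obtain Df Dg where D: "\<And>x. x \<in> S \<Longrightarrow> (f has_derivative blinfun_apply (Df x)) (at x)" "C1_on S Df"
    "\<And>x. x \<in> S \<Longrightarrow> (g has_derivative blinfun_apply (Dg x)) (at x)" "C1_on S Dg"
    using assms unfolding C2_on_iff by metis
  have "((\<lambda>x. f x + g x) has_derivative blinfun_apply (Df x + Dg x)) (at x)" if "x \<in> S" for x
    using has_derivative_add[OF D(1,3)[OF that]]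
    by (rule has_derivative_eq_rhs) (simp add: fun_eq_iff blinfun.add_left)
  then show ?thesis
    using C1_on_add[OF D(2,4)] by (rule C2_onI)
qed

lemma C2_on_mult:
  fixes f g :: "'a::real_normed_vector \<Rightarrow> complex"
  assumes "C2_on S f" "C2_on S g"
  shows "C2_on S (\<lambda>x. f x * g x)"
proof -
  obtain Df Dg where D: "\<And>x. x \<in> S \<Longrightarrow> (f has_derivative blinfun_apply (Df x)) (at x)" "C1_on S Df"
    "\<And>x. x \<in> S \<Longrightarrow> (g has_derivative blinfun_apply (Dg x)) (at x)" "C1_on S Dg"
    using assms unfolding C2_on_iff by metis
  define D where "D x = (blinfun_mult_right (f x) o\<^sub>L Dg x) + (blinfun_mult_right (g x) o\<^sub>L Df x)" for x
  have "((\<lambda>x. f x * g x) has_derivative blinfun_apply (D x)) (at x)" if "x \<in> S" for x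
    using has_derivative_mult[OF D(1,3)[OF that]]
    by (rule has_derivative_eq_rhs) (simp add: D_def fun_eq_iff blinfun.add_left mult.commute)
  moreover have "C1_on S D"
    unfolding D_def[abs_def]
    by (intro C1_on_add C1_on_bounded_bilinear[OF bounded_bilinear_blinfun_compose] D
      C1_on_bounded_linear[OF bounded_linear_blinfun_mult_right] C2_on_imp_C1_on assms)
  ultimately show ?thesis by (rule C2_onI)
qed

lemma C2_on_power:
  fixes f :: "'a::real_normed_vector \<Rightarrow> complex"
  shows "C2_on S f \<Longrightarrow> C2_on S (\<lambda>x. f x ^ k)"
  by (induction k) (auto intro: C2_on_const C2_on_mult)

lemma C2_on_prod:
  fixes f :: "'i \<Rightarrow> 'a::real_normed_vector \<Rightarrow> complex"
  assumes "finite I" "\<And>i. i \<in> I \<Longrightarrow> C2_on S (f i)"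
  shows "C2_on S (\<lambda>x. \<Prod>i\<in>I. f i x)"
  using assms by (induction I rule: finite_induct) (auto intro: C2_on_const C2_on_mult)

text \<open>
  The derivative \<open>- f'/f^2\<close> contains \<open>1/f\<close> again.  Continuity of this formula first shows that \<open>1/f\<close>
  is \<open>C1\<close>, and then the formula itself is a product of \<open>C1\<close> functions.
\<close>

lemma C2_on_inverse:
  fixes f :: "'a::real_normed_vector \<Rightarrow> complex"
  assumes f: "C2_on S f" and nz: "\<And>x. x \<in> S \<Longrightarrow> f x \<noteq> 0"
  shows "C2_on S (\<lambda>x. inverse (f x))"
proof -
  obtain Df where D: "\<And>x. x \<in> S \<Longrightarrow> (f has_derivative blinfun_apply (Df x)) (at x)" "C1_on S Df"
    using f unfolding C2_on_iff by metis
  define D where "D x = blinfun_mult_right (- 1 * (inverse (f x) * inverse (f x))) o\<^sub>L Df x" for x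
  have d: "((\<lambda>x. inverse (f x)) has_derivative blinfun_apply (D x)) (at x)" if "x \<in> S" for x
    using Deriv.has_derivative_inverse[OF nz[OF that] D(1)[OF that]]
    by (rule has_derivative_eq_rhs) (simp add: D_def fun_eq_iff)
  have "continuous_on S D"
    unfolding D_def[abs_def]
    using C1_on_imp_continuous_on[OF C2_on_imp_C1_on[OF f]] C1_on_imp_continuous_on[OF D(2)] nz
    by (intro continuous_intros bounded_linear.continuous_on[OF bounded_linear_blinfun_mult_right]) auto
  with d have inv: "C1_on S (\<lambda>x. inverse (f x))" by (rule C1_onI)
  have "C1_on S D"
    unfolding D_def[abs_def]
    by (intro C1_on_bounded_bilinear[OF bounded_bilinear_blinfun_compose] D
      C1_on_bounded_linear[OF bounded_linear_blinfun_mult_right]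
      C1_on_bounded_linear[OF bounded_linear_mult_right] C1_on_bounded_bilinear[OF bounded_bilinear_mult] inv)
  with d show ?thesis by (rule C2_onI)
qed

section \<open>Holomorphic functions are harmonic\<close>

text \<open>
  The second derivative of \<open>g\<close> in the direction \<open>v\<close> is \<open>v^2 * g''\<close>, and \<open>1 + \<i>^2 = 0\<close>.
\<close>

lemma holomorphic_imp_harmonic_on:
  assumes U: "open U" and g: "g holomorphic_on U"
  shows "harmonic_on U g"
proof -
  have der: "(h has_derivative blinfun_apply (blinfun_mult_right (deriv h x))) (at x)"
    if "h holomorphic_on U" "x \<in> U" for h x
    using holomorphic_derivI[OF that(1) U that(2)] by (simp add: has_field_derivative_def)
  note g' = holomorphic_deriv[OF g U]
  have "continuous_on U (\<lambda>x. blinfun_mult_right (deriv (deriv g) x))"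
    by (intro bounded_linear.continuous_on[OF bounded_linear_blinfun_mult_right]
      holomorphic_on_imp_continuous_on holomorphic_deriv[OF g' U])
  then have "C1_on U (deriv g)" using der[OF g'] by (intro C1_onI)
  then have "C1_on U (\<lambda>x. blinfun_mult_right (deriv g x))"
    by (rule C1_on_bounded_linear[OF bounded_linear_blinfun_mult_right])
  with der[OF g] have C2: "C2_on U g" by (rule C2_onI)
  have dd: "((\<lambda>t. h (\<zeta> + t *\<^sub>R v)) has_vector_derivative v * deriv h \<zeta>) (at 0)"
    if "h holomorphic_on U" "\<zeta> \<in> U" for h \<zeta> v
  proof -
    have "((\<lambda>t. \<zeta> + of_real t * v) has_vector_derivative v) (at 0)"
      by (auto intro!: derivative_eq_intros)
    from field_vector_diff_chain_at[OF this, of h] holomorphic_derivI[OF that(1) U that(2)]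
    show ?thesis by (simp add: o_def scaleR_conv_of_real)
  qed
  have dd2: "dir_deriv v (dir_deriv v g) \<zeta> = v * v * deriv (deriv g) \<zeta>" if \<zeta>: "\<zeta> \<in> U" for v \<zeta>
  proof -
    have first: "dir_deriv v g \<xi> = v * deriv g \<xi>" if "\<xi> \<in> U" for \<xi>
      unfolding dir_deriv_def by (rule vector_derivative_at[OF dd[OF g that]])
    have "((\<lambda>t. \<zeta> + t *\<^sub>R v) \<longlongrightarrow> \<zeta> + 0 *\<^sub>R v) (nhds 0)"
      by (intro tendsto_intros filterlim_ident)
    then have ev: "\<forall>\<^sub>F t in nhds 0. \<zeta> + t *\<^sub>R v \<in> U"
      using U \<zeta> by (auto dest: topological_tendstoD)
    have "dir_deriv v (dir_deriv v g) \<zeta> = vector_derivative (\<lambda>t. v * deriv g (\<zeta> + t *\<^sub>R v)) (at 0)"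
      unfolding dir_deriv_def[of v "dir_deriv v g"]
      by (rule vector_derivative_cong_eq) (use ev in \<open>auto simp: first elim!: eventually_mono\<close>)
    also have "((\<lambda>t. v * deriv g (\<zeta> + t *\<^sub>R v)) has_vector_derivative v * (v * deriv (deriv g) \<zeta>)) (at 0)"
      by (rule bounded_linear.has_vector_derivative[OF bounded_linear_mult_right dd[OF g' \<zeta>]])
    then have "vector_derivative (\<lambda>t. v * deriv g (\<zeta> + t *\<^sub>R v)) (at 0) = v * (v * deriv (deriv g) \<zeta>)"
      by (rule vector_derivative_at)
    finally show ?thesis by (simp add: mult.assoc)
  qed
  show ?thesis unfolding harmonic_on_def using C2 dd2 by simp
qed

section \<open>The extremal function\<close>

definition mi_monomial :: "('n::finite \<Rightarrow> nat) \<Rightarrow> complex ^ 'n \<Rightarrow> complex" where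
  "mi_monomial m z = (\<Prod>j\<in>UNIV. (z $ j) ^ m j)"

lemma norm_mi_monomial_less_1:
  assumes z: "z \<in> unit_polydisc" and m: "m \<noteq> (\<lambda>_. 0)"
  shows "cmod (mi_monomial m z) < 1"
proof -
  obtain j where j: "m j \<noteq> 0" using m by auto
  have le: "cmod (z $ i) < 1" for i using z by (simp add: mem_unit_polydisc)
  have "cmod (mi_monomial m z) = cmod (z $ j) ^ m j * (\<Prod>i\<in>UNIV - {j}. cmod (z $ i) ^ m i)"
    by (simp add: mi_monomial_def prod.remove[of UNIV j] norm_mult norm_power flip: prod_norm)
  also have "\<dots> \<le> cmod (z $ j) ^ m j * 1"
    using le by (intro mult_left_mono prod_le_1) (simp_all add: power_le_one less_imp_le)
  also have "\<dots> < 1" using le[of j] j by (simp add: power_less_one_iff)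
  finally show ?thesis .
qed

text \<open>
  This is \<open>1 - (1 + w) / (1 - w)\<close> for \<open>w = z^m\<close>: the map \<open>(1 + w) / (1 - w)\<close> onto the right
  half-plane is extremal for \<open>higher_deriv_le_Re\<close> at the origin, and the substitution of a monomial moves its first
  coefficient to \<open>z^m\<close>.
\<close>

definition extremal :: "('n::finite \<Rightarrow> nat) \<Rightarrow> complex ^ 'n \<Rightarrow> complex" where
  "extremal m z = - 2 * mi_monomial m z / (1 - mi_monomial m z)"

lemma extremal_alt:
  assumes "z \<in> unit_polydisc" "m \<noteq> (\<lambda>_. 0)"
  shows "1 - mi_monomial m z \<noteq> 0" "extremal m z = 2 + - 2 * inverse (1 + - 1 * mi_monomial m z)"
proof -
  show "1 - mi_monomial m z \<noteq> 0" using norm_mi_monomial_less_1[OF assms] by auto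
  then show "extremal m z = 2 + - 2 * inverse (1 + - 1 * mi_monomial m z)"
    by (simp add: extremal_def field_simps)
qed

text \<open>
  Equivalent to \<open>Re (1/u) \<ge> 1/2\<close> for \<open>u = 1 - w\<close>, which is \<open>\<bar>u\<bar>^2 \<le> 2 * Re u\<close>, that is \<open>\<bar>w\<bar> \<le> 1\<close>.
\<close>

lemma Re_extremal_le_1:
  assumes "z \<in> unit_polydisc" "m \<noteq> (\<lambda>_. 0)"
  shows "Re (extremal m z) \<le> 1"
proof -
  define u where "u = 1 - mi_monomial m z"
  have nz: "u \<noteq> 0" using extremal_alt(1)[OF assms] by (simp add: u_def)
  have "(cmod (mi_monomial m z))\<^sup>2 < 1" using norm_mi_monomial_less_1[OF assms] by (simp add: power_less_one_iff)
  then have "(cmod u)\<^sup>2 \<le> 2 * Re u"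
    unfolding u_def cmod_power2 by (simp add: power2_eq_square algebra_simps)
  moreover have "0 < (cmod u)\<^sup>2" using nz by simp
  ultimately have "1 \<le> 2 * (Re u / (cmod u)\<^sup>2)" by (simp add: field_simps)
  moreover define r where "r = inverse u"
  have "Re r = Re u / (cmod u)\<^sup>2" by (simp add: r_def cmod_power2)
  ultimately have "1 \<le> 2 * Re r" by (simp only:)
  moreover have "extremal m z = 2 + - 2 * r"
    using extremal_alt(2)[OF assms] by (simp add: u_def r_def)
  ultimately show ?thesis by simp
qed

lemma extremal_holomorphic:
  fixes \<gamma> :: "complex \<Rightarrow> complex ^ 'n"
  assumes m: "m \<noteq> (\<lambda>_. 0)" and \<gamma>: "\<And>\<zeta>. \<zeta> \<in> U \<Longrightarrow> \<gamma> \<zeta> \<in> unit_polydisc"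
    and hol: "\<And>j. (\<lambda>\<zeta>. \<gamma> \<zeta> $ j) holomorphic_on U"
  shows "(\<lambda>\<zeta>. extremal m (\<gamma> \<zeta>)) holomorphic_on U"
proof -
  have "(\<lambda>\<zeta>. mi_monomial m (\<gamma> \<zeta>)) holomorphic_on U"
    unfolding mi_monomial_def by (intro holomorphic_intros hol)
  then show ?thesis
    unfolding extremal_def using extremal_alt(1)[OF \<gamma> m] by (intro holomorphic_intros) auto
qed

lemma C2_on_cong:
  assumes "open S" "\<And>x. x \<in> S \<Longrightarrow> f x = g x" "C2_on S f"
  shows "C2_on S g"
proof -
  have "(g has_derivative D) (at x)" if "(f has_derivative D) (at x)" "x \<in> S" for D x
    by (rule has_derivative_transform_within_open[OF that(1) assms(1) that(2)]) (rule assms(2))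
  then show ?thesis using assms(3) unfolding C2_on_iff by blast
qed

lemma extremal_C2:
  fixes m :: "'n::finite \<Rightarrow> nat"
  assumes m: "m \<noteq> (\<lambda>_. 0)"
  shows "C2_on unit_polydisc (extremal m)"
proof (rule C2_on_cong[OF open_unit_polydisc])
  show "C2_on unit_polydisc (\<lambda>z :: complex ^ 'n. 2 + - 2 * inverse (1 + - 1 * mi_monomial m z))"
    unfolding mi_monomial_def
    by (intro C2_on_add C2_on_const C2_on_mult C2_on_inverse C2_on_prod C2_on_power
        C2_on_bounded_linear bounded_linear_vec_nth)
      (use extremal_alt(1)[OF _ m] in \<open>auto simp: mi_monomial_def\<close>)
qed (simp add: extremal_alt(2)[OF _ m])

text \<open>
  A segment that leaves the domain meets its boundary, at a distance from \<open>z\<close> not exceeding the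
  length of the segment.
\<close>

lemma segment_in_domain:
  fixes z :: "complex ^ 'n"
  assumes z: "z \<in> \<Omega>" and \<theta>: "norm \<theta> = 1"
    and \<zeta>: "frontier \<Omega> = {} \<or> cmod \<zeta> < infdist z (frontier \<Omega>)"
  shows "z + \<zeta> *s \<theta> \<in> \<Omega>"
proof (rule ccontr)
  assume out: "z + \<zeta> *s \<theta> \<notin> \<Omega>"
  have n: "norm (\<zeta> *s \<theta>) = cmod \<zeta>"
    using \<theta> by (simp add: norm_vec_def L2_set_def norm_mult power_mult_distrib real_sqrt_mult flip: sum_distrib_left)
  have "closed_segment z (z + \<zeta> *s \<theta>) \<inter> frontier \<Omega> \<noteq> {}"
    using z out by (intro connected_Int_frontier) auto
  then obtain w where w: "w \<in> closed_segment z (z + \<zeta> *s \<theta>)" "w \<in> frontier \<Omega>" by blast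
  have "infdist z (frontier \<Omega>) \<le> dist z w" using w(2) by (rule infdist_le)
  also have "\<dots> \<le> dist z (z + \<zeta> *s \<theta>)"
    using w(1) by (metis dist_commute segment_bound(1) dist_norm norm_minus_commute)
  also have "\<dots> = cmod \<zeta>" by (simp add: dist_norm n)
  finally show False using \<zeta> w(2) by auto
qed

lemma extremal_pluriharmonic:
  fixes m :: "'n::finite \<Rightarrow> nat"
  assumes m: "m \<noteq> (\<lambda>_. 0)"
  shows "pluriharmonic_on unit_polydisc (extremal m)"
  unfolding pluriharmonic_on_def
proof (intro conjI ballI allI impI extremal_C2[OF m])
  fix z \<theta> :: "complex ^ 'n"
  assume z: "z \<in> unit_polydisc" and \<theta>: "norm \<theta> = 1"
  let ?U = "{\<zeta>. frontier (unit_polydisc :: (complex ^ 'n) set) = {} \<or>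
    cmod \<zeta> < infdist z (frontier unit_polydisc)}"
  show "harmonic_on ?U (\<lambda>\<zeta>. extremal m (z + \<zeta> *s \<theta>))"
  proof (rule holomorphic_imp_harmonic_on)
    show "open ?U" by (intro open_Collect_disj open_Collect_less continuous_intros open_Collect_const)
    show "(\<lambda>\<zeta>. extremal m (z + \<zeta> *s \<theta>)) holomorphic_on ?U"
      by (rule extremal_holomorphic[OF m])
        (use segment_in_domain[OF z \<theta>] in \<open>auto intro!: holomorphic_intros\<close>)
  qed
qed

lemma extremal_sep_holo:
  fixes m :: "'n::finite \<Rightarrow> nat"
  assumes m: "m \<noteq> (\<lambda>_. 0)"
  shows "sep_holo (extremal m)"
proof (rule sep_holo_isContI)
  fix z :: "complex ^ 'n" assume z: "z \<in> unit_polydisc"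
  show "isCont (extremal m) z"
    using C1_on_imp_continuous_on[OF C2_on_imp_C1_on[OF extremal_C2[OF m]]] z
      continuous_on_eq_continuous_at[OF open_unit_polydisc] by blast
  fix j
  have "(\<lambda>\<zeta>. vec_upd z j \<zeta> $ i) holomorphic_on ball 0 1" for i
    by (cases "i = j") (auto intro!: holomorphic_intros)
  then show "(\<lambda>\<zeta>. extremal m (vec_upd z j \<zeta>)) holomorphic_on ball 0 1"
    using z by (intro extremal_holomorphic[OF m]) auto
qed

lemma higher_deriv_power_times_at_0:
  assumes S: "S holomorphic_on ball 0 1"
  shows "(deriv ^^ k) (\<lambda>\<zeta>. \<zeta> ^ k * S \<zeta>) 0 = fact k * S (0::complex)"
proof -
  have pw: "(deriv ^^ i) (\<lambda>\<zeta>. \<zeta> ^ k) 0 = (if i = k then fact k else 0 :: complex)" if "i \<le> k" for i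
    using higher_deriv_power[of i 0 k 0] that by (auto simp: pochhammer_fact power_0_left)
  have "(deriv ^^ k) (\<lambda>\<zeta>. \<zeta> ^ k * S \<zeta>) 0 =
      (\<Sum>i = 0..k. of_nat (k choose i) * (deriv ^^ i) (\<lambda>\<zeta>. \<zeta> ^ k) 0 * (deriv ^^ (k - i)) S 0)"
    by (rule higher_deriv_mult[OF _ S]) (auto intro!: holomorphic_intros)
  also have "\<dots> = (\<Sum>i = 0..k. if i = k then fact k * S 0 else 0)"
    by (rule sum.cong) (auto simp: pw)
  finally show ?thesis by simp
qed

text \<open>
  After the coordinates in \<open>xs\<close> have been processed, only the values at points with these coordinates
  zero are needed.  There the slice of the current function in a new coordinate \<open>j\<close> is
  \<open>\<zeta> ^ m j * S \<zeta>\<close> with \<open>S\<close> holomorphic, and \<open>higher_deriv_power_times_at_0\<close> evaluates its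
  derivative.  Keeping the full monomial in the denominator covers the cases \<open>m j = 0\<close> and \<open>m j > 0\<close>
  at once.
\<close>

lemma extremal_derivative:
  fixes m :: "'n::finite \<Rightarrow> nat"
  assumes m: "m \<noteq> (\<lambda>_. 0)"
  shows "distinct xs \<Longrightarrow> sep_holo (foldr (\<lambda>j. wirtinger j ^^ m j) xs (extremal m)) \<and>
    (\<forall>z\<in>unit_polydisc. (\<forall>j\<in>set xs. z $ j = 0) \<longrightarrow>
      foldr (\<lambda>j. wirtinger j ^^ m j) xs (extremal m) z =
        - 2 * (\<Prod>j\<in>set xs. fact (m j)) * (\<Prod>j\<in>- set xs. (z $ j) ^ m j) / (1 - mi_monomial m z))"
proof (induction xs)
  case Nil
  then show ?case by (simp add: extremal_sep_holo[OF m]) (simp add: extremal_def mi_monomial_def)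
next
  case (Cons j xs)
  define q where "q = foldr (\<lambda>j. wirtinger j ^^ m j) xs (extremal m)"
  have q: "sep_holo q" and IH: "\<And>z. z \<in> unit_polydisc \<Longrightarrow> (\<forall>j\<in>set xs. z $ j = 0) \<Longrightarrow>
      q z = - 2 * (\<Prod>j\<in>set xs. fact (m j)) * (\<Prod>j\<in>- set xs. (z $ j) ^ m j) / (1 - mi_monomial m z)"
    using Cons by (auto simp: q_def)
  have j: "j \<notin> set xs" using Cons.prems by simp
  have sep: "sep_holo ((wirtinger j ^^ m j) q)"
    by (rule sep_holo_cong[OF _ sep_holo_coord_deriv_funpow[OF q]]) (simp add: wirtinger_funpow[OF q])
  have "(wirtinger j ^^ m j) q z =
      - 2 * (\<Prod>i\<in>set (j # xs). fact (m i)) * (\<Prod>i\<in>- set (j # xs). (z $ i) ^ m i) / (1 - mi_monomial m z)"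
    if z: "z \<in> unit_polydisc" "\<forall>i\<in>set (j # xs). z $ i = 0" for z
  proof -
    define R where "R = (\<Prod>i\<in>- set (j # xs). (z $ i) ^ m i)"
    define S where "S \<zeta> = - 2 * (\<Prod>i\<in>set xs. fact (m i)) * R / (1 - mi_monomial m (vec_upd z j \<zeta>))" for \<zeta>
    have slice: "q (vec_upd z j \<zeta>) = \<zeta> ^ m j * S \<zeta>" if "\<zeta> \<in> ball 0 1" for \<zeta>
    proof -
      have "- set xs = insert j (- set (j # xs))" using j by auto
      then have "(\<Prod>i\<in>- set xs. (vec_upd z j \<zeta> $ i) ^ m i) =
          \<zeta> ^ m j * (\<Prod>i\<in>- set (j # xs). (vec_upd z j \<zeta> $ i) ^ m i)"
        by simp
      also have "(\<Prod>i\<in>- set (j # xs). (vec_upd z j \<zeta> $ i) ^ m i) = R"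
        unfolding R_def by (rule prod.cong) auto
      finally show ?thesis
        using IH[of "vec_upd z j \<zeta>"] z that j by (auto simp: S_def)
    qed
    have hm: "(\<lambda>\<zeta>. vec_upd z j \<zeta> $ i) holomorphic_on ball 0 1" for i
      by (cases "i = j") (auto intro!: holomorphic_intros)
    have "(\<lambda>\<zeta>. mi_monomial m (vec_upd z j \<zeta>)) holomorphic_on ball 0 1"
      unfolding mi_monomial_def by (intro holomorphic_intros hm)
    then have Sh: "S holomorphic_on ball 0 1"
      unfolding S_def[abs_def] using extremal_alt(1)[OF _ m] z(1) by (intro holomorphic_intros) auto
    have "(wirtinger j ^^ m j) q z = (deriv ^^ m j) (\<lambda>\<zeta>. q (vec_upd z j \<zeta>)) 0"
      using z wirtinger_funpow[OF q z(1)] by (simp add: coord_deriv_funpow)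
    also have "\<dots> = (deriv ^^ m j) (\<lambda>\<zeta>. \<zeta> ^ m j * S \<zeta>) 0"
      by (rule higher_deriv_transform_within_open[OF sep_holo_slice[OF q z(1), of j] _ open_ball])
        (use slice Sh in \<open>auto intro!: holomorphic_intros\<close>)
    also have "\<dots> = fact (m j) * S 0" by (rule higher_deriv_power_times_at_0[OF Sh])
    finally show ?thesis
      using z(2) j vec_upd_same[of z j] by (simp add: S_def R_def)
  qed
  with sep show ?case by (simp add: q_def)
qed

text \<open>
  The first genuine \<open>\<partial>/\<partial>cnj z_j\<close> annihilates a holomorphic function; before it nothing changes, and
  after it everything stays zero.
\<close>

lemma wirtinger_bar_iterate_sep_holo:
  assumes q: "sep_holo q"
  shows "foldr (\<lambda>j. wirtinger_bar j ^^ m j) xs q = q \<and> (\<forall>j\<in>set xs. m j = 0) \<or>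
    (\<forall>z\<in>unit_polydisc. foldr (\<lambda>j. wirtinger_bar j ^^ m j) xs q z = 0)"
proof -
  have zero: "(wirtinger_bar j ^^ Suc k) g z = 0"
    if g: "sep_holo g" and "z \<in> unit_polydisc" for g j k z
    using that(2)
  proof (induction k arbitrary: z)
    case 0
    then show ?case using wirtinger_sep_holo(2)[OF g] by simp
  next
    case (Suc k)
    have "wirtinger_bar j ((wirtinger_bar j ^^ Suc k) g) z = wirtinger_bar j (\<lambda>_. 0) z"
      by (rule wirtinger_cong) (use Suc in auto)
    also have "\<dots> = 0"
      using Suc.prems by (intro wirtinger_sep_holo(2) sep_holo_isContI) auto
    finally show ?case by simp
  qed
  show ?thesis
  proof (induction xs)
    case (Cons j xs)
    let ?g = "foldr (\<lambda>j. wirtinger_bar j ^^ m j) xs q"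
    have "sep_holo ?g"
      using Cons.IH
    proof
      assume "\<forall>z\<in>unit_polydisc. ?g z = 0"
      then show ?thesis by (intro sep_holo_cong[of "\<lambda>_. 0" ?g] sep_holo_isContI) auto
    qed (use q in auto)
    from zero[OF this] show ?case using Cons.IH by (cases "m j") auto
  qed simp
qed

lemma extremal_mixed_deriv_at_0:
  fixes m :: "'n::{finite,linorder} \<Rightarrow> nat"
  assumes m: "m \<noteq> (\<lambda>_. 0)"
  shows "mixed_deriv wirtinger m (extremal m) 0 + cnj (mixed_deriv wirtinger_bar m (extremal m) 0)
    = - 2 * of_real (mi_fact m)" "extremal m 0 = 0"
proof -
  have 0: "0 \<in> (unit_polydisc :: (complex, 'n) vec set)" by (simp add: mem_unit_polydisc)
  have ex: "\<exists>j. m j \<noteq> 0" using m by auto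
  then have m0: "mi_monomial m 0 = 0" by (simp add: mi_monomial_def power_0_left)
  then show "extremal m 0 = 0" by (simp add: extremal_def)
  have "mixed_deriv wirtinger m (extremal m) 0 = - 2 * of_real (mi_fact m)"
    using extremal_derivative[OF m, of "sorted_list_of_set UNIV"] 0
    by (simp add: mixed_deriv_def m0 mi_fact_def)
  moreover have "mixed_deriv wirtinger_bar m (extremal m) 0 = 0"
    using wirtinger_bar_iterate_sep_holo[OF extremal_sep_holo[OF m], of m "sorted_list_of_set UNIV"] 0 ex
    by (auto simp: mixed_deriv_def)
  ultimately show "mixed_deriv wirtinger m (extremal m) 0 + cnj (mixed_deriv wirtinger_bar m (extremal m) 0)
    = - 2 * of_real (mi_fact m)" by simp
qed

section \<open>The sharp inequality\<close>

theorem theorem2p10: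
  shows "(\<forall>f :: (complex, 'n::{finite,linorder}) vec \<Rightarrow> complex.
      pluriharmonic_on unit_polydisc f \<and> (\<forall>w\<in>unit_polydisc. Re (f w) \<le> 1) \<longrightarrow>
      (\<forall>z\<in>unit_polydisc. \<forall>m. m \<noteq> (\<lambda>_. 0) \<longrightarrow>
        cmod (mixed_deriv wirtinger m f z + cnj (mixed_deriv wirtinger_bar m f z))
          \<le> 2 * mi_fact m * (1 - Re (f z)) *
            ((1 + linf_norm z) ^ (mi_size m - mi_supp_card m) / (1 - (linf_norm z)\<^sup>2) ^ mi_size m)))
    \<and> (\<forall>(m :: 'n \<Rightarrow> nat) C. m \<noteq> (\<lambda>_. 0) \<and> C < 2 \<longrightarrow>
      (\<exists>f :: (complex, 'n) vec \<Rightarrow> complex. \<exists>z\<in>unit_polydisc.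
        pluriharmonic_on unit_polydisc f \<and> (\<forall>w\<in>unit_polydisc. Re (f w) \<le> 1) \<and>
        cmod (mixed_deriv wirtinger m f z + cnj (mixed_deriv wirtinger_bar m f z))
          > C * mi_fact m * (1 - Re (f z)) *
            ((1 + linf_norm z) ^ (mi_size m - mi_supp_card m) / (1 - (linf_norm z)\<^sup>2) ^ mi_size m)))"
proof (intro conjI allI impI ballI)
  fix f :: "(complex, 'n) vec \<Rightarrow> complex" and z :: "(complex, 'n) vec" and m :: "'n \<Rightarrow> nat"
  assume "pluriharmonic_on unit_polydisc f \<and> (\<forall>w\<in>unit_polydisc. Re (f w) \<le> 1)"
    "z \<in> unit_polydisc" "m \<noteq> (\<lambda>_. 0)"
  then show "cmod (mixed_deriv wirtinger m f z + cnj (mixed_deriv wirtinger_bar m f z))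
      \<le> 2 * mi_fact m * (1 - Re (f z)) *
        ((1 + linf_norm z) ^ (mi_size m - mi_supp_card m) / (1 - (linf_norm z)\<^sup>2) ^ mi_size m)"
    by (intro mixed_deriv_bound) auto
next
  fix m :: "'n \<Rightarrow> nat" and C :: real
  assume "m \<noteq> (\<lambda>_. 0) \<and> C < 2"
  then have m: "m \<noteq> (\<lambda>_. 0)" and C: "C < 2" by auto
  have pos: "0 < mi_fact m" by (simp add: mi_fact_def prod_pos)
  have l0: "linf_norm (0 :: (complex, 'n) vec) = 0" by (simp add: linf_norm_def)
  have "cmod (- 2 * complex_of_real (mi_fact m)) = 2 * mi_fact m" using pos by (simp add: norm_mult)
  then have "C * mi_fact m * (1 - Re (extremal m 0)) *
      ((1 + linf_norm (0 :: (complex, 'n) vec)) ^ (mi_size m - mi_supp_card m) /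
        (1 - (linf_norm (0 :: (complex, 'n) vec))\<^sup>2) ^ mi_size m)
    < cmod (mixed_deriv wirtinger m (extremal m) 0 + cnj (mixed_deriv wirtinger_bar m (extremal m) 0))"
    unfolding extremal_mixed_deriv_at_0[OF m] l0 using C pos by simp
  moreover have "(0 :: (complex, 'n) vec) \<in> unit_polydisc" by (simp add: mem_unit_polydisc)
  ultimately show "\<exists>f :: (complex, 'n) vec \<Rightarrow> complex. \<exists>z\<in>unit_polydisc.
        pluriharmonic_on unit_polydisc f \<and> (\<forall>w\<in>unit_polydisc. Re (f w) \<le> 1) \<and>
        cmod (mixed_deriv wirtinger m f z + cnj (mixed_deriv wirtinger_bar m f z))
          > C * mi_fact m * (1 - Re (f z)) *
            ((1 + linf_norm z) ^ (mi_size m - mi_supp_card m) / (1 - (linf_norm z)\<^sup>2) ^ mi_size m)"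
    using extremal_pluriharmonic[OF m] Re_extremal_le_1[OF _ m] by blast
qed

end
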